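(* Let $K$ be a field, let $A$ be an s-unital $K$-algebra, and let $B_1,B_2,\dots$ be a sequence of unital $K$-algebras. Let $B=\bigotimes_{i=1}^\infty B_i$ and $R=A\otimes_K B$. If the identity element of each $B_i$ is properly infinite, then $R$ is properly purely infinite.
   Context: Rings and algebras are associative and not necessarily unital unless stated. A ring $R$ is s-unital if for each $x\in R$ there exist $u,v\in R$ with $ux=xv=x$. For a ring $R$, an element $a\in R$ is properly infinite if $a\neq 0$ and $a\oplus a\precsim a$, i.e. there exist $\alpha_1,\alpha_2,\beta_1,\beta_2\in R$ with $\alpha_i a\beta_j=\delta_{ij}a$ for all $i,j\in\{1,2\}$. (For idempotents this agrees with the usual notion.) A ring is properly purely infinite if every nonzero element of it is properly infinite. The infinite tensor product $\bigotimes_{i=1}^\infty B_i$ is the direct limit of the sequence $B_1\to B_1\otimes_K B_2\to B_1\otimes_K B_2\otimes_K B_3\to\cdots$, where all connecting maps have the form $b\mapsto b\otimes 1$. *)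

theory Defs
  imports "HOL-Algebra.Module" "HOL-Algebra.QuotRing" "HOL-Algebra.Product_Groups"
begin

section \<open>Associative algebras, not necessarily unital\<close>

text \<open>The record type of HOL-Algebra always carries a field \<open>one\<close>; it is meaningless for the
  algebras in the sense of \<open>k_algebra\<close> and constrained only in \<open>unital_k_algebra\<close>. The library
  locale \<open>algebra\<close> is not used because it requires a commutative unital multiplication.\<close>

definition k_algebra :: "('k, 'm) ring_scheme \<Rightarrow> ('k, 'a, 'n) module_scheme \<Rightarrow> bool" where
  "k_algebra K A \<longleftrightarrow> module K A \<and>
     (\<forall>x\<in>carrier A. \<forall>y\<in>carrier A. x \<otimes>\<^bsub>A\<^esub> y \<in> carrier A) \<and>
     (\<forall>x\<in>carrier A. \<forall>y\<in>carrier A. \<forall>z\<in>carrier A.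
        (x \<otimes>\<^bsub>A\<^esub> y) \<otimes>\<^bsub>A\<^esub> z = x \<otimes>\<^bsub>A\<^esub> (y \<otimes>\<^bsub>A\<^esub> z) \<and>
        (x \<oplus>\<^bsub>A\<^esub> y) \<otimes>\<^bsub>A\<^esub> z = x \<otimes>\<^bsub>A\<^esub> z \<oplus>\<^bsub>A\<^esub> y \<otimes>\<^bsub>A\<^esub> z \<and>
        z \<otimes>\<^bsub>A\<^esub> (x \<oplus>\<^bsub>A\<^esub> y) = z \<otimes>\<^bsub>A\<^esub> x \<oplus>\<^bsub>A\<^esub> z \<otimes>\<^bsub>A\<^esub> y) \<and>
     (\<forall>k\<in>carrier K. \<forall>x\<in>carrier A. \<forall>y\<in>carrier A.
        (k \<odot>\<^bsub>A\<^esub> x) \<otimes>\<^bsub>A\<^esub> y = k \<odot>\<^bsub>A\<^esub> (x \<otimes>\<^bsub>A\<^esub> y) \<and>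
        x \<otimes>\<^bsub>A\<^esub> (k \<odot>\<^bsub>A\<^esub> y) = k \<odot>\<^bsub>A\<^esub> (x \<otimes>\<^bsub>A\<^esub> y))"

definition unital_k_algebra :: "('k, 'm) ring_scheme \<Rightarrow> ('k, 'a, 'n) module_scheme \<Rightarrow> bool" where
  "unital_k_algebra K A \<longleftrightarrow> k_algebra K A \<and> monoid A"

definition s_unital :: "('a, 'n) ring_scheme \<Rightarrow> bool" where
  "s_unital R \<longleftrightarrow>
     (\<forall>x\<in>carrier R. \<exists>u\<in>carrier R. \<exists>v\<in>carrier R. u \<otimes>\<^bsub>R\<^esub> x = x \<and> x \<otimes>\<^bsub>R\<^esub> v = x)"

definition properly_infinite :: "('a, 'n) ring_scheme \<Rightarrow> 'a \<Rightarrow> bool" where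
  "properly_infinite R a \<longleftrightarrow> a \<in> carrier R \<and> a \<noteq> \<zero>\<^bsub>R\<^esub> \<and>
     (\<exists>\<alpha>\<^sub>1\<in>carrier R. \<exists>\<alpha>\<^sub>2\<in>carrier R. \<exists>\<beta>\<^sub>1\<in>carrier R. \<exists>\<beta>\<^sub>2\<in>carrier R.
        \<alpha>\<^sub>1 \<otimes>\<^bsub>R\<^esub> a \<otimes>\<^bsub>R\<^esub> \<beta>\<^sub>1 = a \<and> \<alpha>\<^sub>1 \<otimes>\<^bsub>R\<^esub> a \<otimes>\<^bsub>R\<^esub> \<beta>\<^sub>2 = \<zero>\<^bsub>R\<^esub> \<and>
        \<alpha>\<^sub>2 \<otimes>\<^bsub>R\<^esub> a \<otimes>\<^bsub>R\<^esub> \<beta>\<^sub>1 = \<zero>\<^bsub>R\<^esub> \<and> \<alpha>\<^sub>2 \<otimes>\<^bsub>R\<^esub> a \<otimes>\<^bsub>R\<^esub> \<beta>\<^sub>2 = a)"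

definition properly_purely_infinite :: "('a, 'n) ring_scheme \<Rightarrow> bool" where
  "properly_purely_infinite R \<longleftrightarrow> (\<forall>a\<in>carrier R. a \<noteq> \<zero>\<^bsub>R\<^esub> \<longrightarrow> properly_infinite R a)"

section \<open>Free modules and quotients\<close>

definition single :: "('k, 'm) ring_scheme \<Rightarrow> 'x \<Rightarrow> 'x \<Rightarrow> 'k" where
  "single K x = (\<lambda>y. if y = x then \<one>\<^bsub>K\<^esub> else \<zero>\<^bsub>K\<^esub>)"

text \<open>The free \<open>K\<close>-module on the set \<open>carrier S\<close>, realised as the finitely supported functions that
  vanish outside \<open>carrier S\<close>, with the bilinear multiplication extending that of the
  semigroup \<open>S\<close>.\<close>

definition free_algebra ::
  "('k, 'm) ring_scheme \<Rightarrow> ('x, 'n) monoid_scheme \<Rightarrow> ('k, 'x \<Rightarrow> 'k) module" where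
  "free_algebra K S =
     \<lparr>carrier = {f. (\<forall>x\<in>carrier S. f x \<in> carrier K) \<and> (\<forall>x. x \<notin> carrier S \<longrightarrow> f x = \<zero>\<^bsub>K\<^esub>) \<and>
                    finite {x. f x \<noteq> \<zero>\<^bsub>K\<^esub>}},
      monoid.mult = (\<lambda>f g z. \<Oplus>\<^bsub>K\<^esub>p\<in>{p. f (fst p) \<noteq> \<zero>\<^bsub>K\<^esub> \<and> g (snd p) \<noteq> \<zero>\<^bsub>K\<^esub> \<and> fst p \<otimes>\<^bsub>S\<^esub> snd p = z}.
                       f (fst p) \<otimes>\<^bsub>K\<^esub> g (snd p)),
      monoid.one = single K \<one>\<^bsub>S\<^esub>,
      ring.zero = (\<lambda>x. \<zero>\<^bsub>K\<^esub>),
      ring.add = (\<lambda>f g x. f x \<oplus>\<^bsub>K\<^esub> g x),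
      module.smult = (\<lambda>k f x. k \<otimes>\<^bsub>K\<^esub> f x)\<rparr>"

definition submodule_span ::
  "('k, 'm) ring_scheme \<Rightarrow> ('k, 'a, 'n) module_scheme \<Rightarrow> 'a set \<Rightarrow> 'a set" where
  "submodule_span K M X = \<Inter>{N. submodule N K M \<and> X \<subseteq> N}"

definition quot_algebra :: "('k, 'a, 'n) module_scheme \<Rightarrow> 'a set \<Rightarrow> ('k, 'a set) module" where
  "quot_algebra F N = ring.extend (FactRing F N)
     \<lparr>module.smult = (\<lambda>k C. \<Union>c\<in>C. N +>\<^bsub>F\<^esub> (k \<odot>\<^bsub>F\<^esub> c))\<rparr>"

section \<open>The tensor product of two algebras\<close>

text \<open>As a module this is the free module on \<open>A \<times> B\<close> modulo the submodule spanned by the bilinearity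
  relations. That submodule is an ideal of \<open>free_algebra K (A \<times>\<times> B)\<close>, and the induced
  multiplication is \<open>(a \<otimes> b)(a' \<otimes> b') = aa' \<otimes> bb'\<close>.\<close>

definition tensor_rels ::
  "('k, 'm) ring_scheme \<Rightarrow> ('k, 'a, 'n) module_scheme \<Rightarrow> ('k, 'b, 'p) module_scheme
    \<Rightarrow> ('a \<times> 'b \<Rightarrow> 'k) set" where
  "tensor_rels K A B = (let F = free_algebra K (A \<times>\<times> B); \<delta> = single K in
     {\<delta> (a \<oplus>\<^bsub>A\<^esub> a', b) \<ominus>\<^bsub>F\<^esub> (\<delta> (a, b) \<oplus>\<^bsub>F\<^esub> \<delta> (a', b)) | a a' b.
        a \<in> carrier A \<and> a' \<in> carrier A \<and> b \<in> carrier B} \<union>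
     {\<delta> (a, b \<oplus>\<^bsub>B\<^esub> b') \<ominus>\<^bsub>F\<^esub> (\<delta> (a, b) \<oplus>\<^bsub>F\<^esub> \<delta> (a, b')) | a b b'.
        a \<in> carrier A \<and> b \<in> carrier B \<and> b' \<in> carrier B} \<union>
     {\<delta> (k \<odot>\<^bsub>A\<^esub> a, b) \<ominus>\<^bsub>F\<^esub> k \<odot>\<^bsub>F\<^esub> \<delta> (a, b) | k a b.
        k \<in> carrier K \<and> a \<in> carrier A \<and> b \<in> carrier B} \<union>
     {\<delta> (a, k \<odot>\<^bsub>B\<^esub> b) \<ominus>\<^bsub>F\<^esub> k \<odot>\<^bsub>F\<^esub> \<delta> (a, b) | k a b.
        k \<in> carrier K \<and> a \<in> carrier A \<and> b \<in> carrier B})"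

definition tensor_algebra ::
  "('k, 'm) ring_scheme \<Rightarrow> ('k, 'a, 'n) module_scheme \<Rightarrow> ('k, 'b, 'p) module_scheme
    \<Rightarrow> ('k, ('a \<times> 'b \<Rightarrow> 'k) set) module" where
  "tensor_algebra K A B = (let F = free_algebra K (A \<times>\<times> B) in
     quot_algebra F (submodule_span K F (tensor_rels K A B)))"

section \<open>Finite and infinite tensor products\<close>

text \<open>The tensor product of the family \<open>B i\<close>, \<open>i \<in> I\<close>, for finite \<open>I\<close>: the free module on the
  tuples in the product of the \<open>B i\<close> modulo the multilinearity relations, with componentwise
  multiplication of pure tensors. Iterating \<open>tensor_algebra\<close> instead would change the type at
  every step, so the \<open>n\<close>-fold tensor products could not form a sequence.\<close>

definition multi_tensor_rels ::
  "('k, 'm) ring_scheme \<Rightarrow> 'i set \<Rightarrow> ('i \<Rightarrow> ('k, 'b, 'p) module_scheme) \<Rightarrow> (('i \<Rightarrow> 'b) \<Rightarrow> 'k) set" where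
  "multi_tensor_rels K I B = (let F = free_algebra K (product_group I B); \<delta> = single K in
     {\<delta> (t(i := x \<oplus>\<^bsub>B i\<^esub> y)) \<ominus>\<^bsub>F\<^esub> (\<delta> (t(i := x)) \<oplus>\<^bsub>F\<^esub> \<delta> (t(i := y))) | t i x y.
        t \<in> (\<Pi>\<^sub>E i\<in>I. carrier (B i)) \<and> i \<in> I \<and> x \<in> carrier (B i) \<and> y \<in> carrier (B i)} \<union>
     {\<delta> (t(i := k \<odot>\<^bsub>B i\<^esub> x)) \<ominus>\<^bsub>F\<^esub> k \<odot>\<^bsub>F\<^esub> \<delta> (t(i := x)) | t i k x.
        t \<in> (\<Pi>\<^sub>E i\<in>I. carrier (B i)) \<and> i \<in> I \<and> k \<in> carrier K \<and> x \<in> carrier (B i)})"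

definition multi_tensor_ideal ::
  "('k, 'm) ring_scheme \<Rightarrow> 'i set \<Rightarrow> ('i \<Rightarrow> ('k, 'b, 'p) module_scheme) \<Rightarrow> (('i \<Rightarrow> 'b) \<Rightarrow> 'k) set" where
  "multi_tensor_ideal K I B =
     submodule_span K (free_algebra K (product_group I B)) (multi_tensor_rels K I B)"

definition multi_tensor_algebra ::
  "('k, 'm) ring_scheme \<Rightarrow> 'i set \<Rightarrow> ('i \<Rightarrow> ('k, 'b, 'p) module_scheme)
    \<Rightarrow> ('k, (('i \<Rightarrow> 'b) \<Rightarrow> 'k) set) module" where
  "multi_tensor_algebra K I B =
     quot_algebra (free_algebra K (product_group I B)) (multi_tensor_ideal K I B)"

definition pure_tensor ::
  "('k, 'm) ring_scheme \<Rightarrow> 'i set \<Rightarrow> ('i \<Rightarrow> ('k, 'b, 'p) module_scheme) \<Rightarrow> ('i \<Rightarrow> 'b)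
    \<Rightarrow> (('i \<Rightarrow> 'b) \<Rightarrow> 'k) set" where
  "pure_tensor K I B t =
     multi_tensor_ideal K I B +>\<^bsub>free_algebra K (product_group I B)\<^esub> single K t"

text \<open>The connecting map \<open>b \<mapsto> b \<otimes> 1\<close> from \<open>B 0 \<otimes> \<dots> \<otimes> B n\<close> to \<open>B 0 \<otimes> \<dots> \<otimes> B (Suc n)\<close>: the linear
  map induced on cosets by sending the pure tensor of \<open>t\<close> to that of \<open>t(Suc n := 1)\<close>.\<close>

definition tensor_step ::
  "('k, 'm) ring_scheme \<Rightarrow> (nat \<Rightarrow> ('k, 'b, 'p) module_scheme) \<Rightarrow> nat
    \<Rightarrow> ((nat \<Rightarrow> 'b) \<Rightarrow> 'k) set \<Rightarrow> ((nat \<Rightarrow> 'b) \<Rightarrow> 'k) set" where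
  "tensor_step K B n C = (let T = multi_tensor_algebra K {..Suc n} B in
     the_elem ((\<lambda>f. \<Oplus>\<^bsub>T\<^esub>t\<in>{t. f t \<noteq> \<zero>\<^bsub>K\<^esub>}.
       f t \<odot>\<^bsub>T\<^esub> pure_tensor K {..Suc n} B (t(Suc n := \<one>\<^bsub>B (Suc n)\<^esub>))) ` C))"

text \<open>The direct limit of a sequence \<open>T 0 \<rightarrow> T 1 \<rightarrow> \<dots>\<close> of algebras with connecting maps
  \<open>\<phi> n : T n \<rightarrow> T (Suc n)\<close>: pairs \<open>(n, x)\<close> with \<open>x \<in> T n\<close>, identified when their images in some
  later \<open>T l\<close> agree.\<close>

primrec iter_map :: "(nat \<Rightarrow> 'a \<Rightarrow> 'a) \<Rightarrow> nat \<Rightarrow> nat \<Rightarrow> 'a \<Rightarrow> 'a" where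
  "iter_map \<phi> m 0 x = x"
| "iter_map \<phi> m (Suc d) x = \<phi> (m + d) (iter_map \<phi> m d x)"

definition trans_map :: "(nat \<Rightarrow> 'a \<Rightarrow> 'a) \<Rightarrow> nat \<Rightarrow> nat \<Rightarrow> 'a \<Rightarrow> 'a" where
  "trans_map \<phi> m l = iter_map \<phi> m (l - m)"

definition limit_rel ::
  "(nat \<Rightarrow> ('a, 'n) ring_scheme) \<Rightarrow> (nat \<Rightarrow> 'a \<Rightarrow> 'a) \<Rightarrow> ((nat \<times> 'a) \<times> (nat \<times> 'a)) set" where
  "limit_rel T \<phi> = {((m, x), (n, y)) | m x n y. x \<in> carrier (T m) \<and> y \<in> carrier (T n) \<and>
     (\<exists>l. m \<le> l \<and> n \<le> l \<and> trans_map \<phi> m l x = trans_map \<phi> n l y)}"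

definition direct_limit ::
  "(nat \<Rightarrow> ('k, 'a, 'n) module_scheme) \<Rightarrow> (nat \<Rightarrow> 'a \<Rightarrow> 'a) \<Rightarrow> ('k, (nat \<times> 'a) set) module" where
  "direct_limit T \<phi> = (let cls = (\<lambda>n x. limit_rel T \<phi> `` {(n, x)}) in
     \<lparr>carrier = (SIGMA n:UNIV. carrier (T n)) // limit_rel T \<phi>,
      monoid.mult = (\<lambda>X Y. \<Union>(m, x)\<in>X. \<Union>(n, y)\<in>Y. let l = max m n in
                cls l (trans_map \<phi> m l x \<otimes>\<^bsub>T l\<^esub> trans_map \<phi> n l y)),
      monoid.one = cls 0 \<one>\<^bsub>T 0\<^esub>,
      ring.zero = cls 0 \<zero>\<^bsub>T 0\<^esub>,
      ring.add = (\<lambda>X Y. \<Union>(m, x)\<in>X. \<Union>(n, y)\<in>Y. let l = max m n in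
                cls l (trans_map \<phi> m l x \<oplus>\<^bsub>T l\<^esub> trans_map \<phi> n l y)),
      module.smult = (\<lambda>k X. \<Union>(n, x)\<in>X. cls n (k \<odot>\<^bsub>T n\<^esub> x))\<rparr>)"

definition infinite_tensor_algebra ::
  "('k, 'm) ring_scheme \<Rightarrow> (nat \<Rightarrow> ('k, 'b, 'p) module_scheme)
    \<Rightarrow> ('k, (nat \<times> ((nat \<Rightarrow> 'b) \<Rightarrow> 'k) set) set) module" where
  "infinite_tensor_algebra K B =
     direct_limit (\<lambda>n. multi_tensor_algebra K {..n} B) (tensor_step K B)"

end

theory Submission
  imports Defs
begin

text \<open>Let \<open>r = \<Sum> a\<^sub>p \<otimes> b\<^sub>p\<close> be a nonzero element of \<open>A \<otimes> B\<close>. The finitely many \<open>b\<^sub>p\<close> all come from one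
  stage \<open>B 0 \<otimes> \<dots> \<otimes> B n\<close> of the limit, so one stage later each of them has the entry \<open>1\<close> in the
  factor \<open>B (Suc n)\<close>. Since that \<open>1\<close> is properly infinite, there are \<open>x\<^sub>1, x\<^sub>2, y\<^sub>1, y\<^sub>2\<close> in \<open>B (Suc n)\<close>
  such that \<open>x\<^sub>i 1 y\<^sub>j\<close> is \<open>1\<close> for \<open>i = j\<close> and \<open>0\<close> otherwise. Placed in the factor \<open>B (Suc n)\<close>, with
  \<open>1\<close> in all other factors, they satisfy \<open>x\<^sub>i b\<^sub>p y\<^sub>j = b\<^sub>p\<close> or \<open>0\<close> accordingly
  (\<open>slot_mult_step_mult_slot\<close>, \<open>cls_slot_scaling\<close>). As \<open>A\<close> is s-unital, there are \<open>u, v \<in> A\<close> with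
  \<open>u a\<^sub>p = a\<^sub>p = a\<^sub>p v\<close> for all \<open>p\<close> (\<open>s_unital_finite_left\<close>, \<open>s_unital_finite_right\<close>). Then
  \<open>\<alpha>\<^sub>i = u \<otimes> x\<^sub>i\<close> and \<open>\<beta>\<^sub>j = v \<otimes> y\<^sub>j\<close> show that \<open>r\<close> is properly infinite.

  For this computation the concrete constructions have to be known to behave as expected. A tensor
  product is a free algebra modulo a span of relations; multiplication of cosets is well defined
  because the relations are stable under multiplication by basis elements (\<open>N_mult\<close>,
  \<open>tensor_presented\<close>, \<open>multi_tensor_presented\<close>). The connecting maps are linear extensions that
  kill the relations (\<open>tensor_step_hom\<close>). In a direct limit of such maps every finite set of elements
  comes from one stage (\<open>common_level\<close>), and the operations can be computed there (\<open>cls_hom\<close>).\<close>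

section \<open>Bilinear multiplications on modules\<close>

text \<open>The products \<open>(\<alpha> r) \<beta>\<close> in the final computation are bracketed in one way and evaluated on
  generators, so bilinearity is the structure that has to be carried through free algebras,
  quotients and limits.\<close>

locale nonassoc_algebra = module K M
  for K :: "('k, 'm) ring_scheme" and M :: "('k, 'a, 'n) module_scheme" (structure) +
  assumes mult_closed [simp, intro]:
      "x \<in> carrier M \<Longrightarrow> y \<in> carrier M \<Longrightarrow> x \<otimes> y \<in> carrier M"
    and add_mult: "x \<in> carrier M \<Longrightarrow> y \<in> carrier M \<Longrightarrow> z \<in> carrier M
      \<Longrightarrow> (x \<oplus> y) \<otimes> z = x \<otimes> z \<oplus> y \<otimes> z"
    and mult_add: "x \<in> carrier M \<Longrightarrow> y \<in> carrier M \<Longrightarrow> z \<in> carrier M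
      \<Longrightarrow> z \<otimes> (x \<oplus> y) = z \<otimes> x \<oplus> z \<otimes> y"
    and smult_mult: "k \<in> carrier K \<Longrightarrow> x \<in> carrier M \<Longrightarrow> y \<in> carrier M
      \<Longrightarrow> (k \<odot> x) \<otimes> y = k \<odot> (x \<otimes> y)"
    and mult_smult: "k \<in> carrier K \<Longrightarrow> x \<in> carrier M \<Longrightarrow> y \<in> carrier M
      \<Longrightarrow> x \<otimes> (k \<odot> y) = k \<odot> (x \<otimes> y)"
begin

lemma zero_mult [simp]: "x \<in> carrier M \<Longrightarrow> \<zero> \<otimes> x = \<zero>"
  using smult_mult[of "\<zero>\<^bsub>K\<^esub>" "\<zero>" x] by simp

lemma mult_zero [simp]: "x \<in> carrier M \<Longrightarrow> x \<otimes> \<zero> = \<zero>"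
  using mult_smult[of "\<zero>\<^bsub>K\<^esub>" x "\<zero>"] by simp

lemma minus_eq_smult: "x \<in> carrier M \<Longrightarrow> \<ominus> x = (\<ominus>\<^bsub>K\<^esub> \<one>\<^bsub>K\<^esub>) \<odot> x"
  by (simp add: smult_l_minus)

lemma minus_mult: "x \<in> carrier M \<Longrightarrow> y \<in> carrier M \<Longrightarrow> z \<in> carrier M
    \<Longrightarrow> (x \<ominus> y) \<otimes> z = x \<otimes> z \<ominus> y \<otimes> z"
  by (simp add: M.minus_eq minus_eq_smult add_mult smult_mult)

lemma mult_minus: "x \<in> carrier M \<Longrightarrow> y \<in> carrier M \<Longrightarrow> z \<in> carrier M
    \<Longrightarrow> z \<otimes> (x \<ominus> y) = z \<otimes> x \<ominus> z \<otimes> y"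
  by (simp add: M.minus_eq minus_eq_smult mult_add mult_smult)

end

lemma k_algebra_imp_nonassoc_algebra: "k_algebra K A \<Longrightarrow> nonassoc_algebra K A"
  unfolding k_algebra_def
  by (auto intro!: nonassoc_algebra.intro nonassoc_algebra_axioms.intro)

text \<open>Preservation of zero is part of the definition because the target of such a map is, in the
  quotient and limit constructions below, not yet known to be a module.\<close>

definition lin_hom ::
  "('k, 'm) ring_scheme \<Rightarrow> ('k, 'a, 'n) module_scheme \<Rightarrow> ('k, 'b, 'p) module_scheme \<Rightarrow> ('a \<Rightarrow> 'b) set" where
  "lin_hom K M L = {h. (\<forall>x\<in>carrier M. h x \<in> carrier L) \<and>
     (\<forall>x\<in>carrier M. \<forall>y\<in>carrier M. h (x \<oplus>\<^bsub>M\<^esub> y) = h x \<oplus>\<^bsub>L\<^esub> h y) \<and>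
     (\<forall>k\<in>carrier K. \<forall>x\<in>carrier M. h (k \<odot>\<^bsub>M\<^esub> x) = k \<odot>\<^bsub>L\<^esub> h x) \<and>
     h \<zero>\<^bsub>M\<^esub> = \<zero>\<^bsub>L\<^esub>}"

definition alg_hom ::
  "('k, 'm) ring_scheme \<Rightarrow> ('k, 'a, 'n) module_scheme \<Rightarrow> ('k, 'b, 'p) module_scheme \<Rightarrow> ('a \<Rightarrow> 'b) set" where
  "alg_hom K M L = {h \<in> lin_hom K M L.
     \<forall>x\<in>carrier M. \<forall>y\<in>carrier M. h (x \<otimes>\<^bsub>M\<^esub> y) = h x \<otimes>\<^bsub>L\<^esub> h y}"

lemma lin_homD:
  assumes "h \<in> lin_hom K M L"
  shows "x \<in> carrier M \<Longrightarrow> h x \<in> carrier L"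
    and "x \<in> carrier M \<Longrightarrow> y \<in> carrier M \<Longrightarrow> h (x \<oplus>\<^bsub>M\<^esub> y) = h x \<oplus>\<^bsub>L\<^esub> h y"
    and "k \<in> carrier K \<Longrightarrow> x \<in> carrier M \<Longrightarrow> h (k \<odot>\<^bsub>M\<^esub> x) = k \<odot>\<^bsub>L\<^esub> h x"
    and "h \<zero>\<^bsub>M\<^esub> = \<zero>\<^bsub>L\<^esub>"
  using assms by (auto simp: lin_hom_def)

lemma alg_homD:
  assumes "h \<in> alg_hom K M L"
  shows "h \<in> lin_hom K M L"
    and "x \<in> carrier M \<Longrightarrow> h x \<in> carrier L"
    and "x \<in> carrier M \<Longrightarrow> y \<in> carrier M \<Longrightarrow> h (x \<oplus>\<^bsub>M\<^esub> y) = h x \<oplus>\<^bsub>L\<^esub> h y"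
    and "k \<in> carrier K \<Longrightarrow> x \<in> carrier M \<Longrightarrow> h (k \<odot>\<^bsub>M\<^esub> x) = k \<odot>\<^bsub>L\<^esub> h x"
    and "h \<zero>\<^bsub>M\<^esub> = \<zero>\<^bsub>L\<^esub>"
    and "x \<in> carrier M \<Longrightarrow> y \<in> carrier M \<Longrightarrow> h (x \<otimes>\<^bsub>M\<^esub> y) = h x \<otimes>\<^bsub>L\<^esub> h y"
  using assms by (auto simp: alg_hom_def lin_hom_def)

lemma lin_hom_minus:
  assumes "h \<in> lin_hom K M L" "module K M" "module K L" "x \<in> carrier M" "y \<in> carrier M"
  shows "h (x \<ominus>\<^bsub>M\<^esub> y) = h x \<ominus>\<^bsub>L\<^esub> h y"
proof -
  interpret M: module K M by fact
  interpret L: module K L by fact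
  have "h (\<ominus>\<^bsub>M\<^esub> y) = \<ominus>\<^bsub>L\<^esub> h y"
    using lin_homD[OF assms(1)] assms(5) M.smult_l_minus[of "\<one>\<^bsub>K\<^esub>" y] L.smult_l_minus[of "\<one>\<^bsub>K\<^esub>" "h y"]
    by (metis M.one_closed M.add.inv_closed L.smult_one M.smult_one M.R.add.inv_closed)
  then show ?thesis
    using lin_homD[OF assms(1)] assms(4,5) by (simp add: a_minus_def)
qed

text \<open>Each axiom concerns at most three elements, so all of them hold in \<open>L\<close> as soon as any three
  elements of \<open>L\<close> lie in the image of one algebra under an operation-preserving map. A quotient is
  the case of a single surjection, a direct limit the case of the maps from the stages.\<close>

lemma nonassoc_algebra_of_local_images:
  fixes L :: "('k, 'b, 'p) module_scheme" and K :: "('k, 'm) ring_scheme"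
    and T :: "'i \<Rightarrow> ('k, 'a, 'n) module_scheme"
  assumes K: "cring K" and zero: "\<zero>\<^bsub>L\<^esub> \<in> carrier L"
    and T: "\<And>i. nonassoc_algebra K (T i)" and h: "\<And>i. h i \<in> alg_hom K (T i) L"
    and local: "\<And>x y z. x \<in> carrier L \<Longrightarrow> y \<in> carrier L \<Longrightarrow> z \<in> carrier L \<Longrightarrow>
      \<exists>i. {x, y, z} \<subseteq> h i ` carrier (T i)"
  shows "nonassoc_algebra K L"
proof -
  have loc: P if xyz: "x \<in> carrier L" "y \<in> carrier L" "z \<in> carrier L"
    and P: "\<And>i x' y' z'. x' \<in> carrier (T i) \<Longrightarrow> y' \<in> carrier (T i) \<Longrightarrow> z' \<in> carrier (T i)
      \<Longrightarrow> x = h i x' \<Longrightarrow> y = h i y' \<Longrightarrow> z = h i z' \<Longrightarrow> P"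
    for x y z P
  proof -
    obtain i where "{x, y, z} \<subseteq> h i ` carrier (T i)"
      using local[OF xyz] by blast
    then obtain x' y' z' where "x' \<in> carrier (T i)" "y' \<in> carrier (T i)" "z' \<in> carrier (T i)"
      "x = h i x'" "y = h i y'" "z = h i z'"
      by auto
    then show P by (rule P)
  qed
  interpret K: cring K by fact
  note hom = alg_homD(2-6)[OF h]
  have T_mod: "module K (T i)" and T_ab: "abelian_group (T i)" and T_am: "abelian_monoid (T i)" for i
    using T[of i] by (auto simp: nonassoc_algebra_def module_def abelian_group_def)
  note closed = abelian_monoid.a_closed[OF T_am] abelian_monoid.zero_closed[OF T_am]
    abelian_group.a_inv_closed[OF T_ab] module.smult_closed[OF T_mod] nonassoc_algebra.mult_closed[OF T]
  have ab: "abelian_group L"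
  proof (rule abelian_groupI)
    fix x y assume x: "x \<in> carrier L" and y: "y \<in> carrier L"
    show "x \<oplus>\<^bsub>L\<^esub> y \<in> carrier L"
      by (rule loc[OF x y y]) (simp flip: hom(2) add: hom(1) closed)
    show "x \<oplus>\<^bsub>L\<^esub> y = y \<oplus>\<^bsub>L\<^esub> x"
      by (rule loc[OF x y y]) (simp flip: hom(2) add: abelian_monoid.a_comm[OF T_am])
    show "\<exists>y\<in>carrier L. y \<oplus>\<^bsub>L\<^esub> x = \<zero>\<^bsub>L\<^esub>"
    proof (rule loc[OF x x x])
      fix i x' assume a: "x' \<in> carrier (T i)" "x = h i x'"
      show ?thesis using a hom(1)
        by (intro bexI[of _ "h i (\<ominus>\<^bsub>T i\<^esub> x')"])
          (simp_all flip: hom(2) hom(4)[of i] add: closed abelian_group.l_neg[OF T_ab])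
    qed
    show "\<zero>\<^bsub>L\<^esub> \<oplus>\<^bsub>L\<^esub> x = x"
    proof (rule loc[OF x x x])
      fix i x' assume a: "x' \<in> carrier (T i)" "x = h i x'"
      then show ?thesis
        by (simp flip: hom(2) hom(4)[of i] add: closed abelian_monoid.l_zero[OF T_am])
    qed
    fix z assume z: "z \<in> carrier L"
    show "x \<oplus>\<^bsub>L\<^esub> y \<oplus>\<^bsub>L\<^esub> z = x \<oplus>\<^bsub>L\<^esub> (y \<oplus>\<^bsub>L\<^esub> z)"
      by (rule loc[OF x y z]) (simp flip: hom(2) add: closed abelian_monoid.a_assoc[OF T_am])
  qed (rule zero)
  have md: "module K L"
  proof (rule moduleI[OF K ab])
    fix a b x assume k: "a \<in> carrier K" "b \<in> carrier K" and x: "x \<in> carrier L"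
    have kk: "a \<oplus>\<^bsub>K\<^esub> b \<in> carrier K" "a \<otimes>\<^bsub>K\<^esub> b \<in> carrier K"
      using k by simp_all
    show "a \<odot>\<^bsub>L\<^esub> x \<in> carrier L"
      using k by - (rule loc[OF x x x], simp flip: hom(3) add: hom(1) closed)
    show "(a \<oplus>\<^bsub>K\<^esub> b) \<odot>\<^bsub>L\<^esub> x = a \<odot>\<^bsub>L\<^esub> x \<oplus>\<^bsub>L\<^esub> b \<odot>\<^bsub>L\<^esub> x"
      using k kk by - (rule loc[OF x x x],
        simp flip: hom(2,3) add: closed module.smult_l_distr[OF T_mod])
    show "(a \<otimes>\<^bsub>K\<^esub> b) \<odot>\<^bsub>L\<^esub> x = a \<odot>\<^bsub>L\<^esub> (b \<odot>\<^bsub>L\<^esub> x)"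
      using k kk by - (rule loc[OF x x x],
        simp flip: hom(3) add: closed module.smult_assoc1[OF T_mod])
  next
    fix a x y assume k: "a \<in> carrier K" and x: "x \<in> carrier L" and y: "y \<in> carrier L"
    show "a \<odot>\<^bsub>L\<^esub> (x \<oplus>\<^bsub>L\<^esub> y) = a \<odot>\<^bsub>L\<^esub> x \<oplus>\<^bsub>L\<^esub> a \<odot>\<^bsub>L\<^esub> y"
      using k by - (rule loc[OF x y y],
        simp flip: hom(2,3) add: closed module.smult_r_distr[OF T_mod])
  next
    fix x assume x: "x \<in> carrier L"
    show "\<one>\<^bsub>K\<^esub> \<odot>\<^bsub>L\<^esub> x = x"
      by (rule loc[OF x x x]) (simp flip: hom(3) add: module.smult_one[OF T_mod])
  qed
  show ?thesis
  proof (intro nonassoc_algebra.intro[OF md] nonassoc_algebra_axioms.intro)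
    fix x y assume x: "x \<in> carrier L" and y: "y \<in> carrier L"
    show "x \<otimes>\<^bsub>L\<^esub> y \<in> carrier L"
      by (rule loc[OF x y y]) (simp flip: hom(5) add: hom(1) closed)
    fix k assume k: "k \<in> carrier K"
    show "(k \<odot>\<^bsub>L\<^esub> x) \<otimes>\<^bsub>L\<^esub> y = k \<odot>\<^bsub>L\<^esub> (x \<otimes>\<^bsub>L\<^esub> y)"
      using k by - (rule loc[OF x y y],
        simp flip: hom(3,5) add: closed nonassoc_algebra.smult_mult[OF T])
    show "x \<otimes>\<^bsub>L\<^esub> (k \<odot>\<^bsub>L\<^esub> y) = k \<odot>\<^bsub>L\<^esub> (x \<otimes>\<^bsub>L\<^esub> y)"
      using k by - (rule loc[OF x y y],
        simp flip: hom(3,5) add: closed nonassoc_algebra.mult_smult[OF T])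
  next
    fix x y z assume x: "x \<in> carrier L" and y: "y \<in> carrier L" and z: "z \<in> carrier L"
    show "(x \<oplus>\<^bsub>L\<^esub> y) \<otimes>\<^bsub>L\<^esub> z = x \<otimes>\<^bsub>L\<^esub> z \<oplus>\<^bsub>L\<^esub> y \<otimes>\<^bsub>L\<^esub> z"
      by (rule loc[OF x y z])
        (simp flip: hom(2,5) add: closed nonassoc_algebra.add_mult[OF T])
    show "z \<otimes>\<^bsub>L\<^esub> (x \<oplus>\<^bsub>L\<^esub> y) = z \<otimes>\<^bsub>L\<^esub> x \<oplus>\<^bsub>L\<^esub> z \<otimes>\<^bsub>L\<^esub> y"
      by (rule loc[OF x y z])
        (simp flip: hom(2,5) add: closed nonassoc_algebra.mult_add[OF T])
  qed
qed

section \<open>Free algebras\<close>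

locale free_magma_algebra = K: cring K
  for K :: "('k, 'm) ring_scheme" (structure) and S :: "('x, 's) monoid_scheme" +
  assumes S_closed: "s \<in> carrier S \<Longrightarrow> t \<in> carrier S \<Longrightarrow> s \<otimes>\<^bsub>S\<^esub> t \<in> carrier S"
begin

abbreviation "F \<equiv> free_algebra K S"

lemma free_simps:
  "carrier F = {f. (\<forall>x\<in>carrier S. f x \<in> carrier K) \<and> (\<forall>x. x \<notin> carrier S \<longrightarrow> f x = \<zero>) \<and>
                    finite {x. f x \<noteq> \<zero>}}"
  "\<zero>\<^bsub>F\<^esub> = (\<lambda>x. \<zero>)" "f \<oplus>\<^bsub>F\<^esub> g = (\<lambda>x. f x \<oplus> g x)" "k \<odot>\<^bsub>F\<^esub> f = (\<lambda>x. k \<otimes> f x)"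
  by (simp_all add: free_algebra_def)

lemma coeff_closed [simp, intro]: "f \<in> carrier F \<Longrightarrow> f x \<in> carrier K"
  unfolding free_simps(1) by (cases "x \<in> carrier S") simp_all

lemma support_finite: "f \<in> carrier F \<Longrightarrow> finite {x. f x \<noteq> \<zero>}"
  and support_subset: "f \<in> carrier F \<Longrightarrow> {x. f x \<noteq> \<zero>} \<subseteq> carrier S"
  unfolding free_simps(1) by blast+

lemma free_memI:
  assumes "finite U" "U \<subseteq> carrier S" "\<And>x. x \<in> U \<Longrightarrow> f x \<in> carrier K" "\<And>x. x \<notin> U \<Longrightarrow> f x = \<zero>"
  shows "f \<in> carrier F"
proof -
  have "{x. f x \<noteq> \<zero>} \<subseteq> U" using assms(4) by auto
  then have "finite {x. f x \<noteq> \<zero>}" using assms(1) finite_subset by blast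
  moreover have "f x \<in> carrier K" for x using assms(3,4)[of x] by (cases "x \<in> U") simp_all
  moreover have "f x = \<zero>" if "x \<notin> carrier S" for x using assms(2,4) that by blast
  ultimately show ?thesis unfolding free_simps(1) by simp
qed

lemma single_closed [simp, intro]: "s \<in> carrier S \<Longrightarrow> single K s \<in> carrier F"
  by (rule free_memI[of "{s}"]) (auto simp: single_def)

lemma free_module: "module K F"
proof (rule moduleI)
  show "cring K" by (rule K.cring_axioms)
  show "abelian_group F"
  proof (rule abelian_groupI)
    fix f g assume fg: "f \<in> carrier F" "g \<in> carrier F"
    then show "f \<oplus>\<^bsub>F\<^esub> g \<in> carrier F"
      by (intro free_memI[of "{x. f x \<noteq> \<zero>} \<union> {x. g x \<noteq> \<zero>}"])
        (auto simp: free_simps(2-) support_finite dest: support_subset)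
  next
    fix f assume f: "f \<in> carrier F"
    have "(\<lambda>x. \<ominus> f x) \<in> carrier F"
      using f by (intro free_memI[of "{x. f x \<noteq> \<zero>}"]) (auto simp: support_finite dest: support_subset)
    then show "\<exists>g\<in>carrier F. g \<oplus>\<^bsub>F\<^esub> f = \<zero>\<^bsub>F\<^esub>"
      using f by (intro bexI[of _ "\<lambda>x. \<ominus> f x"]) (auto simp: free_simps(2-) K.l_neg fun_eq_iff)
  qed (auto simp: free_simps(2-) K.a_ac intro: free_memI[of "{}"])
next
  fix k f assume "k \<in> carrier K" "f \<in> carrier F"
  then show "k \<odot>\<^bsub>F\<^esub> f \<in> carrier F"
    by (intro free_memI[of "{x. f x \<noteq> \<zero>}"]) (auto simp: free_simps(2-) support_finite dest: support_subset)
qed (auto simp: free_simps(2-) K.l_distr K.r_distr K.m_assoc)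

sublocale F: module K F by (rule free_module)

text \<open>Summing over a fixed rectangle around the supports, instead of over the index set that depends
  on both factors and on \<open>z\<close>, makes the coefficient visibly bilinear in \<open>f\<close> and \<open>g\<close>.\<close>

lemma mult_coeff:
  assumes f: "f \<in> carrier F" and g: "g \<in> carrier F"
    and U: "finite U" "{x. f x \<noteq> \<zero>} \<subseteq> U" and V: "finite V" "{x. g x \<noteq> \<zero>} \<subseteq> V"
  shows "(f \<otimes>\<^bsub>F\<^esub> g) z =
    (\<Oplus>p\<in>U \<times> V. if fst p \<otimes>\<^bsub>S\<^esub> snd p = z then f (fst p) \<otimes> g (snd p) else \<zero>)"
  unfolding free_algebra_def monoid.simps
  using assms by (intro K.add.finprod_mono_neutral_cong_left) auto

lemma mult_outside:
  assumes f: "f \<in> carrier F" and g: "g \<in> carrier F"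
    and z: "z \<notin> (\<lambda>p. fst p \<otimes>\<^bsub>S\<^esub> snd p) ` ({x. f x \<noteq> \<zero>} \<times> {x. g x \<noteq> \<zero>})"
  shows "(f \<otimes>\<^bsub>F\<^esub> g) z = \<zero>"
proof -
  have "\<not> (f (fst p) \<noteq> \<zero> \<and> g (snd p) \<noteq> \<zero> \<and> fst p \<otimes>\<^bsub>S\<^esub> snd p = z)" for p
  proof
    assume p: "f (fst p) \<noteq> \<zero> \<and> g (snd p) \<noteq> \<zero> \<and> fst p \<otimes>\<^bsub>S\<^esub> snd p = z"
    then have "p \<in> {x. f x \<noteq> \<zero>} \<times> {x. g x \<noteq> \<zero>}" by (simp add: mem_Times_iff)
    from imageI[OF this, of "\<lambda>p. fst p \<otimes>\<^bsub>S\<^esub> snd p"] p z show False by simp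
  qed
  then have "{p. f (fst p) \<noteq> \<zero> \<and> g (snd p) \<noteq> \<zero> \<and> fst p \<otimes>\<^bsub>S\<^esub> snd p = z} = {}"
    by blast
  then show ?thesis unfolding free_algebra_def monoid.simps by (simp only: K.finsum_empty)
qed

lemma free_nonassoc_algebra: "nonassoc_algebra K F"
proof (intro nonassoc_algebra.intro nonassoc_algebra_axioms.intro free_module)
  fix f g assume f: "f \<in> carrier F" and g: "g \<in> carrier F"
  let ?U = "{x. f x \<noteq> \<zero>}" and ?V = "{x. g x \<noteq> \<zero>}"
  note fin = support_finite[OF f] support_finite[OF g]
  show "f \<otimes>\<^bsub>F\<^esub> g \<in> carrier F"
  proof (rule free_memI)
    show "finite ((\<lambda>p. fst p \<otimes>\<^bsub>S\<^esub> snd p) ` (?U \<times> ?V))" using fin by simp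
    show "(\<lambda>p. fst p \<otimes>\<^bsub>S\<^esub> snd p) ` (?U \<times> ?V) \<subseteq> carrier S"
      using support_subset[OF f] support_subset[OF g] by (auto intro!: S_closed)
    show "(f \<otimes>\<^bsub>F\<^esub> g) z \<in> carrier K" for z
      using f g fin by (subst mult_coeff[of f g ?U ?V]) (auto intro!: K.finsum_closed)
  qed (use mult_outside[OF f g] in blast)
  fix k assume k: "k \<in> carrier K"
  have kf: "k \<odot>\<^bsub>F\<^esub> f \<in> carrier F" and kg: "k \<odot>\<^bsub>F\<^esub> g \<in> carrier F" using k f g by auto
  have "((k \<odot>\<^bsub>F\<^esub> f) \<otimes>\<^bsub>F\<^esub> g) z = k \<otimes> (f \<otimes>\<^bsub>F\<^esub> g) z" for z
  proof -
    have "((k \<odot>\<^bsub>F\<^esub> f) \<otimes>\<^bsub>F\<^esub> g) z = (\<Oplus>p\<in>?U \<times> ?V.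
        k \<otimes> (if fst p \<otimes>\<^bsub>S\<^esub> snd p = z then f (fst p) \<otimes> g (snd p) else \<zero>))"
      using f g fin k kf
      by (subst mult_coeff[of _ g ?U ?V])
        (auto simp: free_simps(2-) K.m_assoc intro!: K.finsum_cong')
    then show ?thesis
      using f g fin k by (simp add: mult_coeff[of f g ?U ?V z] K.finsum_rdistr Pi_def)
  qed
  then show "(k \<odot>\<^bsub>F\<^esub> f) \<otimes>\<^bsub>F\<^esub> g = k \<odot>\<^bsub>F\<^esub> (f \<otimes>\<^bsub>F\<^esub> g)"
    by (simp add: free_simps(4) fun_eq_iff)
  have "(f \<otimes>\<^bsub>F\<^esub> (k \<odot>\<^bsub>F\<^esub> g)) z = k \<otimes> (f \<otimes>\<^bsub>F\<^esub> g) z" for z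
  proof -
    have "(f \<otimes>\<^bsub>F\<^esub> (k \<odot>\<^bsub>F\<^esub> g)) z = (\<Oplus>p\<in>?U \<times> ?V.
        k \<otimes> (if fst p \<otimes>\<^bsub>S\<^esub> snd p = z then f (fst p) \<otimes> g (snd p) else \<zero>))"
      using f g fin k kg
      by (subst mult_coeff[of f _ ?U ?V])
        (auto simp: free_simps(2-) K.m_lcomm intro!: K.finsum_cong')
    then show ?thesis
      using f g fin k by (simp add: mult_coeff[of f g ?U ?V z] K.finsum_rdistr Pi_def)
  qed
  then show "f \<otimes>\<^bsub>F\<^esub> (k \<odot>\<^bsub>F\<^esub> g) = k \<odot>\<^bsub>F\<^esub> (f \<otimes>\<^bsub>F\<^esub> g)"
    by (simp add: free_simps(4) fun_eq_iff)
next
  fix f g h assume f: "f \<in> carrier F" and g: "g \<in> carrier F" and h: "h \<in> carrier F"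
  let ?U = "{x. f x \<noteq> \<zero>} \<union> {x. g x \<noteq> \<zero>}" and ?V = "{x. h x \<noteq> \<zero>}"
  have fin: "finite ?U" "finite ?V" using f g h by (auto simp: support_finite)
  have fg: "f \<oplus>\<^bsub>F\<^esub> g \<in> carrier F" using f g by auto
  have "((f \<oplus>\<^bsub>F\<^esub> g) \<otimes>\<^bsub>F\<^esub> h) z = (f \<otimes>\<^bsub>F\<^esub> h) z \<oplus> (g \<otimes>\<^bsub>F\<^esub> h) z" for z
  proof -
    have "((f \<oplus>\<^bsub>F\<^esub> g) \<otimes>\<^bsub>F\<^esub> h) z = (\<Oplus>p\<in>?U \<times> ?V.
        if fst p \<otimes>\<^bsub>S\<^esub> snd p = z then (f \<oplus>\<^bsub>F\<^esub> g) (fst p) \<otimes> h (snd p) else \<zero>)"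
      using f g fin by (intro mult_coeff[OF fg h]) (auto simp: free_simps(3))
    also have "\<dots> = (\<Oplus>p\<in>?U \<times> ?V.
        (if fst p \<otimes>\<^bsub>S\<^esub> snd p = z then f (fst p) \<otimes> h (snd p) else \<zero>) \<oplus>
        (if fst p \<otimes>\<^bsub>S\<^esub> snd p = z then g (fst p) \<otimes> h (snd p) else \<zero>))"
      using f g h by (intro K.finsum_cong') (auto simp: free_simps(3) K.l_distr)
    also have "\<dots> = (f \<otimes>\<^bsub>F\<^esub> h) z \<oplus> (g \<otimes>\<^bsub>F\<^esub> h) z"
      using f g h fin
      by (subst K.finsum_addf) (auto simp: mult_coeff[of f h ?U ?V z] mult_coeff[of g h ?U ?V z])
    finally show ?thesis .
  qed
  then show "(f \<oplus>\<^bsub>F\<^esub> g) \<otimes>\<^bsub>F\<^esub> h = f \<otimes>\<^bsub>F\<^esub> h \<oplus>\<^bsub>F\<^esub> g \<otimes>\<^bsub>F\<^esub> h"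
    by (simp add: free_simps(3) fun_eq_iff)
  have "(h \<otimes>\<^bsub>F\<^esub> (f \<oplus>\<^bsub>F\<^esub> g)) z = (h \<otimes>\<^bsub>F\<^esub> f) z \<oplus> (h \<otimes>\<^bsub>F\<^esub> g) z" for z
  proof -
    have "(h \<otimes>\<^bsub>F\<^esub> (f \<oplus>\<^bsub>F\<^esub> g)) z = (\<Oplus>p\<in>?V \<times> ?U.
        if fst p \<otimes>\<^bsub>S\<^esub> snd p = z then h (fst p) \<otimes> (f \<oplus>\<^bsub>F\<^esub> g) (snd p) else \<zero>)"
      using f g fin by (intro mult_coeff[OF h fg]) (auto simp: free_simps(3))
    also have "\<dots> = (\<Oplus>p\<in>?V \<times> ?U.
        (if fst p \<otimes>\<^bsub>S\<^esub> snd p = z then h (fst p) \<otimes> f (snd p) else \<zero>) \<oplus>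
        (if fst p \<otimes>\<^bsub>S\<^esub> snd p = z then h (fst p) \<otimes> g (snd p) else \<zero>))"
      using f g h by (intro K.finsum_cong') (auto simp: free_simps(3) K.r_distr)
    also have "\<dots> = (h \<otimes>\<^bsub>F\<^esub> f) z \<oplus> (h \<otimes>\<^bsub>F\<^esub> g) z"
      using f g h fin
      by (subst K.finsum_addf) (auto simp: mult_coeff[of h f ?V ?U z] mult_coeff[of h g ?V ?U z])
    finally show ?thesis .
  qed
  then show "h \<otimes>\<^bsub>F\<^esub> (f \<oplus>\<^bsub>F\<^esub> g) = h \<otimes>\<^bsub>F\<^esub> f \<oplus>\<^bsub>F\<^esub> h \<otimes>\<^bsub>F\<^esub> g"
    by (simp add: free_simps(3) fun_eq_iff)
qed

sublocale F: nonassoc_algebra K F by (rule free_nonassoc_algebra)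

lemma single_mult:
  assumes "s \<in> carrier S" "t \<in> carrier S"
  shows "single K s \<otimes>\<^bsub>F\<^esub> single K t = single K (s \<otimes>\<^bsub>S\<^esub> t)"
proof
  fix z
  have "(single K s \<otimes>\<^bsub>F\<^esub> single K t) z =
      (\<Oplus>p\<in>{s} \<times> {t}. if fst p \<otimes>\<^bsub>S\<^esub> snd p = z then single K s (fst p) \<otimes> single K t (snd p) else \<zero>)"
    using assms by (intro mult_coeff single_closed) (auto simp: single_def)
  then show "(single K s \<otimes>\<^bsub>F\<^esub> single K t) z = single K (s \<otimes>\<^bsub>S\<^esub> t) z"
    by (auto simp: single_def)
qed

text \<open>The induction adds only basis elements from the support of \<open>f\<close>. This matters in the final
  computation, where the common local units and the common level of the limit are good for the
  pure tensors occurring in one given \<open>f\<close>, not for all of them.\<close>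

lemma free_induct [consumes 1, case_names zero add]:
  assumes f: "f \<in> carrier F" and zero: "P \<zero>\<^bsub>F\<^esub>"
    and add: "\<And>s k g. f s \<noteq> \<zero> \<Longrightarrow> s \<in> carrier S \<Longrightarrow> k \<in> carrier K \<Longrightarrow> g \<in> carrier F \<Longrightarrow> P g
      \<Longrightarrow> P (k \<odot>\<^bsub>F\<^esub> single K s \<oplus>\<^bsub>F\<^esub> g)"
  shows "P f"
proof -
  have "P g" if "finite U" "U \<subseteq> {x. f x \<noteq> \<zero>}" "g \<in> carrier F" "{x. g x \<noteq> \<zero>} \<subseteq> U" for U g
    using that
  proof (induction U arbitrary: g)
    case empty
    then have "g = \<zero>\<^bsub>F\<^esub>" by (auto simp: free_simps(2))
    then show ?case using zero by simp
  next
    case (insert s U)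
    have s: "f s \<noteq> \<zero>" "s \<in> carrier S" using insert.prems(1) support_subset[OF f] by auto
    define h where "h = (\<lambda>x. if x = s then \<zero> else g x)"
    have h: "h \<in> carrier F"
      using insert.prems(2) by (intro free_memI[of "{x. g x \<noteq> \<zero>}"])
        (auto simp: h_def support_finite dest: support_subset)
    have "P h" using insert.prems h by (intro insert.IH) (auto simp: h_def split: if_splits)
    moreover have "g = g s \<odot>\<^bsub>F\<^esub> single K s \<oplus>\<^bsub>F\<^esub> h"
      using insert.prems(2) by (auto simp: free_simps(2-) h_def single_def fun_eq_iff)
    ultimately show ?case using add[OF s _ h, of "g s"] insert.prems(2) by auto
  qed
  from this[OF support_finite[OF f] _ f] show ?thesis by simp
qed

lemma lin_hom_eqI:
  assumes "\<phi> \<in> lin_hom K F L" "\<psi> \<in> lin_hom K F L" "f \<in> carrier F"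
    and "\<And>s. s \<in> carrier S \<Longrightarrow> f s \<noteq> \<zero> \<Longrightarrow> \<phi> (single K s) = \<psi> (single K s)"
  shows "\<phi> f = \<psi> f"
  using assms(3)
proof (induction rule: free_induct)
  case zero then show ?case using assms(1,2) by (simp add: lin_homD)
next
  case (add s k g)
  then show ?case using assms(4) by (simp add: lin_homD[OF assms(1)] lin_homD[OF assms(2)])
qed

end

text \<open>The linear map that sends the basis element \<open>t\<close> to \<open>g t\<close>; the connecting maps between finite
  tensor products are induced by maps of this form.\<close>

definition lin_ext ::
  "('k, 'm) ring_scheme \<Rightarrow> ('k, 'a, 'n) module_scheme \<Rightarrow> ('x \<Rightarrow> 'a) \<Rightarrow> ('x \<Rightarrow> 'k) \<Rightarrow> 'a" where
  "lin_ext K M g f = (\<Oplus>\<^bsub>M\<^esub>t\<in>{t. f t \<noteq> \<zero>\<^bsub>K\<^esub>}. f t \<odot>\<^bsub>M\<^esub> g t)"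

context free_magma_algebra
begin

lemma lin_ext_eq:
  assumes M: "module K M" and g: "\<And>s. s \<in> carrier S \<Longrightarrow> g s \<in> carrier M"
    and f: "f \<in> carrier F" and U: "finite U" "{t. f t \<noteq> \<zero>} \<subseteq> U" "U \<subseteq> carrier S"
  shows "lin_ext K M g f = (\<Oplus>\<^bsub>M\<^esub>t\<in>U. f t \<odot>\<^bsub>M\<^esub> g t)"
proof -
  interpret M: module K M by (rule M)
  show ?thesis unfolding lin_ext_def
    using U f g by (intro M.add.finprod_mono_neutral_cong_left) auto
qed

lemma lin_ext_single:
  assumes M: "module K M" and g: "\<And>s. s \<in> carrier S \<Longrightarrow> g s \<in> carrier M" and s: "s \<in> carrier S"
  shows "lin_ext K M g (single K s) = g s"
proof -
  interpret M: module K M by (rule M)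
  show ?thesis using s g by (subst lin_ext_eq[OF M g single_closed[OF s], where U = "{s}"]) (auto simp: single_def)
qed

lemma lin_ext_lin_hom:
  assumes M: "module K M" and g: "\<And>s. s \<in> carrier S \<Longrightarrow> g s \<in> carrier M"
  shows "lin_ext K M g \<in> lin_hom K F M"
proof -
  interpret M: module K M by (rule M)
  note eq = lin_ext_eq[OF M, of g, OF g]
  have "lin_ext K M g f \<in> carrier M" if f: "f \<in> carrier F" for f
    using f g support_subset[OF f] by (auto simp: lin_ext_def intro!: M.finsum_closed)
  moreover have "lin_ext K M g (f \<oplus>\<^bsub>F\<^esub> f') = lin_ext K M g f \<oplus>\<^bsub>M\<^esub> lin_ext K M g f'"
    if f: "f \<in> carrier F" "f' \<in> carrier F" for f f'
  proof -
    let ?U = "{x. f x \<noteq> \<zero>} \<union> {x. f' x \<noteq> \<zero>}"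
    have U: "finite ?U" "?U \<subseteq> carrier S" using f by (auto simp: support_finite dest: support_subset)
    have "lin_ext K M g (f \<oplus>\<^bsub>F\<^esub> f') = (\<Oplus>\<^bsub>M\<^esub>t\<in>?U. f t \<odot>\<^bsub>M\<^esub> g t \<oplus>\<^bsub>M\<^esub> f' t \<odot>\<^bsub>M\<^esub> g t)"
      using f U g F.a_closed[OF f] by (subst eq[of _ ?U])
        (auto simp: free_simps(3) M.smult_l_distr intro!: M.finsum_cong' )
    also have "\<dots> = lin_ext K M g f \<oplus>\<^bsub>M\<^esub> lin_ext K M g f'"
      using f U g by (subst M.finsum_addf) (auto simp: eq[of _ ?U])
    finally show ?thesis .
  qed
  moreover have "lin_ext K M g (k \<odot>\<^bsub>F\<^esub> f) = k \<odot>\<^bsub>M\<^esub> lin_ext K M g f"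
    if f: "f \<in> carrier F" and k: "k \<in> carrier K" for f k
  proof -
    let ?U = "{x. f x \<noteq> \<zero>}"
    have U: "finite ?U" "?U \<subseteq> carrier S" using f by (auto simp: support_finite dest: support_subset)
    have "lin_ext K M g (k \<odot>\<^bsub>F\<^esub> f) = (\<Oplus>\<^bsub>M\<^esub>t\<in>?U. k \<odot>\<^bsub>M\<^esub> (f t \<odot>\<^bsub>M\<^esub> g t))"
      using f U g k F.smult_closed[OF k f] by (subst eq[of _ ?U])
        (auto simp: free_simps(4) M.smult_assoc1 intro!: M.finsum_cong')
    also have "\<dots> = k \<odot>\<^bsub>M\<^esub> lin_ext K M g f"
      using f U g k by (subst M.finsum_smult_ldistr[symmetric]) (auto simp: eq[of _ ?U])
    finally show ?thesis .
  qed
  moreover have "lin_ext K M g \<zero>\<^bsub>F\<^esub> = \<zero>\<^bsub>M\<^esub>" by (simp add: lin_ext_def free_simps(2))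
  ultimately show ?thesis by (auto simp: lin_hom_def)
qed

lemma lin_ext_alg_hom:
  assumes M: "nonassoc_algebra K M" and g: "\<And>s. s \<in> carrier S \<Longrightarrow> g s \<in> carrier M"
    and g_mult: "\<And>s t. s \<in> carrier S \<Longrightarrow> t \<in> carrier S \<Longrightarrow> g (s \<otimes>\<^bsub>S\<^esub> t) = g s \<otimes>\<^bsub>M\<^esub> g t"
  shows "lin_ext K M g \<in> alg_hom K F M"
proof -
  interpret M: nonassoc_algebra K M by (rule M)
  note hom = lin_ext_lin_hom[OF M.module_axioms, of g, OF g]
  note single = lin_ext_single[OF M.module_axioms, of g, OF g]
  have 1: "lin_ext K M g (single K s \<otimes>\<^bsub>F\<^esub> f) = g s \<otimes>\<^bsub>M\<^esub> lin_ext K M g f"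
    if s: "s \<in> carrier S" and "f \<in> carrier F" for s f
    using that(2)
  proof (induction rule: free_induct)
    case zero then show ?case using s g by (simp add: lin_homD[OF hom])
  next
    case (add t k h)
    then show ?case using s g
      by (simp add: lin_homD[OF hom] F.mult_add F.mult_smult M.mult_add M.mult_smult single_mult
          single S_closed g_mult)
  qed
  have "lin_ext K M g (f \<otimes>\<^bsub>F\<^esub> f') = lin_ext K M g f \<otimes>\<^bsub>M\<^esub> lin_ext K M g f'"
    if f': "f' \<in> carrier F" and "f \<in> carrier F" for f f'
    using that(2)
  proof (induction rule: free_induct)
    case zero then show ?case using f' by (simp add: lin_homD[OF hom])
  next
    case (add t k h)
    then show ?case using f' g
      by (simp add: lin_homD[OF hom] F.add_mult F.smult_mult M.add_mult M.smult_mult 1 single)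
  qed
  with hom show ?thesis by (simp add: alg_hom_def)
qed

end

section \<open>Quotients of free algebras\<close>

text \<open>Both kinds of tensor product are free algebras modulo a set of relations that multiplication by
  a basis element maps into itself. This stability is what makes the spanned submodule an ideal.\<close>

locale presented_algebra = free_magma_algebra K S
  for K :: "('k, 'm) ring_scheme" (structure) and S :: "('x, 's) monoid_scheme" +
  fixes X :: "('x \<Rightarrow> 'k) set"
  assumes X_subset: "X \<subseteq> carrier F"
    and X_mult_single: "x \<in> X \<Longrightarrow> s \<in> carrier S \<Longrightarrow> x \<otimes>\<^bsub>F\<^esub> single K s \<in> X"
    and single_mult_X: "x \<in> X \<Longrightarrow> s \<in> carrier S \<Longrightarrow> single K s \<otimes>\<^bsub>F\<^esub> x \<in> X"
begin

abbreviation "N \<equiv> submodule_span K F X"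
abbreviation "Q \<equiv> quot_algebra F N"

definition proj :: "('x \<Rightarrow> 'k) \<Rightarrow> ('x \<Rightarrow> 'k) set" where
  "proj f = N +>\<^bsub>F\<^esub> f"

lemma X_subset_N: "X \<subseteq> N"
  by (auto simp: submodule_span_def)

lemma N_least: "submodule H K F \<Longrightarrow> X \<subseteq> H \<Longrightarrow> N \<subseteq> H"
  by (auto simp: submodule_span_def)

lemma N_submodule: "submodule N K F"
proof (rule F.submoduleI)
  show "N \<subseteq> carrier F" by (rule N_least[OF F.carrier_is_submodule X_subset])
  show "\<zero>\<^bsub>F\<^esub> \<in> N"
    by (auto simp: submodule_span_def submodule_def dest!: subgroup.one_closed)
qed (auto simp: submodule_span_def intro: F.submoduleE(3,4,5))

lemma N_subset: "N \<subseteq> carrier F"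
  by (rule F.submoduleE(1)[OF N_submodule])

sublocale N: abelian_subgroup N F
  by (intro abelian_subgroupI3 additive_subgroupI submodule.axioms(1)[OF N_submodule]
      F.abelian_group_axioms)

lemma kernel_submodule:
  assumes h: "h \<in> lin_hom K F L" and L: "module K L" and H: "submodule H K L"
  shows "submodule {f \<in> carrier F. h f \<in> H} K F"
proof -
  interpret L: module K L by (rule L)
  note H' = L.submoduleE[OF H]
  have 0: "\<zero>\<^bsub>L\<^esub> \<in> H" using H by (auto simp: submodule_def dest!: subgroup.one_closed)
  show ?thesis
  proof (rule F.submoduleI)
    fix f assume f: "f \<in> {f \<in> carrier F. h f \<in> H}"
    then have "h (\<zero>\<^bsub>F\<^esub> \<ominus>\<^bsub>F\<^esub> f) = \<zero>\<^bsub>L\<^esub> \<ominus>\<^bsub>L\<^esub> h f"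
      using lin_hom_minus[OF h free_module L, of "\<zero>\<^bsub>F\<^esub>" f] by (simp add: lin_homD[OF h])
    then show "\<ominus>\<^bsub>F\<^esub> f \<in> {f \<in> carrier F. h f \<in> H}"
      using f 0 H' lin_homD(1)[OF h] by (simp add: a_minus_def)
  qed (use 0 H' in \<open>auto simp: lin_homD[OF h]\<close>)
qed

lemma mult_left_lin_hom: "x \<in> carrier F \<Longrightarrow> (\<lambda>y. x \<otimes>\<^bsub>F\<^esub> y) \<in> lin_hom K F F"
  by (auto simp: lin_hom_def F.mult_add F.mult_smult)

lemma mult_right_lin_hom: "y \<in> carrier F \<Longrightarrow> (\<lambda>x. x \<otimes>\<^bsub>F\<^esub> y) \<in> lin_hom K F F"
  by (auto simp: lin_hom_def F.add_mult F.smult_mult)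

lemma generators_in_submodule:
  assumes H: "submodule H K F" and "\<And>s. s \<in> carrier S \<Longrightarrow> single K s \<in> H" and f: "f \<in> carrier F"
  shows "f \<in> H"
  using f
proof (induction rule: free_induct)
  case zero show ?case using H by (auto simp: submodule_def dest!: subgroup.one_closed)
qed (use assms F.submoduleE(4,5)[OF H] in auto)

text \<open>By linearity it suffices to multiply generators. For a fixed basis element \<open>s\<close>, the elements
  whose product with \<open>s\<close> stays in \<open>N\<close> form a submodule containing \<open>X\<close>, hence containing \<open>N\<close>;
  for a fixed \<open>x \<in> N\<close>, the elements whose product with \<open>x\<close> lies in \<open>N\<close> form a submodule
  containing the basis.\<close>

lemma N_mult:
  assumes x: "x \<in> N" and y: "y \<in> carrier F"
  shows "x \<otimes>\<^bsub>F\<^esub> y \<in> N" "y \<otimes>\<^bsub>F\<^esub> x \<in> N"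
proof -
  have x': "x \<in> carrier F" using x N_subset by auto
  have r: "N \<subseteq> {x \<in> carrier F. x \<otimes>\<^bsub>F\<^esub> single K s \<in> N}" if "s \<in> carrier S" for s
    using that X_subset X_subset_N X_mult_single
    by (intro N_least kernel_submodule[OF mult_right_lin_hom free_module N_submodule]) auto
  have l: "N \<subseteq> {x \<in> carrier F. single K s \<otimes>\<^bsub>F\<^esub> x \<in> N}" if "s \<in> carrier S" for s
    using that X_subset X_subset_N single_mult_X
    by (intro N_least kernel_submodule[OF mult_left_lin_hom free_module N_submodule]) auto
  have "y \<in> {y \<in> carrier F. x \<otimes>\<^bsub>F\<^esub> y \<in> N}"
  proof (rule generators_in_submodule[OF kernel_submodule[OF mult_left_lin_hom free_module N_submodule]])
    show "x \<in> carrier F" "y \<in> carrier F" by fact+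
  next
    fix s assume s: "s \<in> carrier S"
    then show "single K s \<in> {y \<in> carrier F. x \<otimes>\<^bsub>F\<^esub> y \<in> N}" using r[OF s] x by auto
  qed
  then show "x \<otimes>\<^bsub>F\<^esub> y \<in> N" by simp
  have "y \<in> {y \<in> carrier F. y \<otimes>\<^bsub>F\<^esub> x \<in> N}"
  proof (rule generators_in_submodule[OF kernel_submodule[OF mult_right_lin_hom free_module N_submodule]])
    show "x \<in> carrier F" "y \<in> carrier F" by fact+
  next
    fix s assume s: "s \<in> carrier S"
    then show "single K s \<in> {y \<in> carrier F. y \<otimes>\<^bsub>F\<^esub> x \<in> N}" using l[OF s] x by auto
  qed
  then show "y \<otimes>\<^bsub>F\<^esub> x \<in> N" by simp
qed

lemma mem_proj_iff: "f \<in> carrier F \<Longrightarrow> g \<in> carrier F \<Longrightarrow> g \<in> proj f \<longleftrightarrow> g \<ominus>\<^bsub>F\<^esub> f \<in> N"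
  by (simp add: proj_def N.a_rcos_module a_minus_def)

lemma mem_projD: "f \<in> carrier F \<Longrightarrow> g \<in> proj f \<Longrightarrow> g \<in> carrier F \<and> proj g = proj f"
  using N.a_elemrcos_carrier[of f g] N.a_repr_independence'[of g f] by (auto simp: proj_def)

lemma self_mem_proj: "f \<in> carrier F \<Longrightarrow> f \<in> proj f"
  unfolding proj_def by (rule N.a_rcos_self)

lemma proj_eqI:
  assumes "f \<in> carrier F" "g \<in> carrier F" "g \<ominus>\<^bsub>F\<^esub> f \<in> N"
  shows "proj g = proj f"
  using assms mem_proj_iff mem_projD by blast

lemma carrier_Q: "carrier Q = proj ` carrier F"
  by (auto simp: quot_algebra_def FactRing_def A_RCOSETS_def' proj_def ring.defs)

lemma Q_zero: "\<zero>\<^bsub>Q\<^esub> = proj \<zero>\<^bsub>F\<^esub>"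
  using N_subset by (simp add: quot_algebra_def FactRing_def proj_def ring.defs)

lemma Q_add: "f \<in> carrier F \<Longrightarrow> g \<in> carrier F \<Longrightarrow> proj f \<oplus>\<^bsub>Q\<^esub> proj g = proj (f \<oplus>\<^bsub>F\<^esub> g)"
  by (simp add: quot_algebra_def FactRing_def proj_def ring.defs N.a_rcos_sum)

lemma Q_smult: "k \<in> carrier K \<Longrightarrow> f \<in> carrier F \<Longrightarrow> k \<odot>\<^bsub>Q\<^esub> proj f = proj (k \<odot>\<^bsub>F\<^esub> f)"
proof -
  assume k: "k \<in> carrier K" and f: "f \<in> carrier F"
  have "proj (k \<odot>\<^bsub>F\<^esub> c) = proj (k \<odot>\<^bsub>F\<^esub> f)" if c: "c \<in> proj f" for c
  proof -
    have c': "c \<in> carrier F" and "c \<ominus>\<^bsub>F\<^esub> f \<in> N"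
      using c f mem_projD mem_proj_iff by blast+
    then have "k \<odot>\<^bsub>F\<^esub> (c \<ominus>\<^bsub>F\<^esub> f) \<in> N" using k F.submoduleE(4)[OF N_submodule] by blast
    then have "k \<odot>\<^bsub>F\<^esub> c \<ominus>\<^bsub>F\<^esub> k \<odot>\<^bsub>F\<^esub> f \<in> N"
      using k f c' by (simp add: F.M.minus_eq F.smult_r_distr F.smult_r_minus)
    then show ?thesis using k f c' by (intro proj_eqI) auto
  qed
  then have "(\<Union>c\<in>proj f. proj (k \<odot>\<^bsub>F\<^esub> c)) = proj (k \<odot>\<^bsub>F\<^esub> f)"
    using self_mem_proj[OF f] by blast
  then show ?thesis by (simp add: quot_algebra_def ring.defs proj_def)
qed

lemma Q_mult: "f \<in> carrier F \<Longrightarrow> g \<in> carrier F \<Longrightarrow> proj f \<otimes>\<^bsub>Q\<^esub> proj g = proj (f \<otimes>\<^bsub>F\<^esub> g)"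
proof -
  assume f: "f \<in> carrier F" and g: "g \<in> carrier F"
  have "proj (c \<otimes>\<^bsub>F\<^esub> d) = proj (f \<otimes>\<^bsub>F\<^esub> g)" if c: "c \<in> proj f" and d: "d \<in> proj g" for c d
  proof -
    have c': "c \<in> carrier F" "c \<ominus>\<^bsub>F\<^esub> f \<in> N" and d': "d \<in> carrier F" "d \<ominus>\<^bsub>F\<^esub> g \<in> N"
      using c d f g mem_projD mem_proj_iff by blast+
    have "proj (c \<otimes>\<^bsub>F\<^esub> d) = proj (f \<otimes>\<^bsub>F\<^esub> d)"
      using N_mult(1)[OF c'(2) d'(1)] c' d' f by (intro proj_eqI) (auto simp: F.minus_mult)
    also have "\<dots> = proj (f \<otimes>\<^bsub>F\<^esub> g)"
      using N_mult(2)[OF d'(2) f] d' f g by (intro proj_eqI) (auto simp: F.mult_minus)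
    finally show ?thesis .
  qed
  then have "(\<Union>c\<in>proj f. \<Union>d\<in>proj g. proj (c \<otimes>\<^bsub>F\<^esub> d)) = proj (f \<otimes>\<^bsub>F\<^esub> g)"
    using self_mem_proj[OF f] self_mem_proj[OF g] by blast
  then show ?thesis by (simp add: quot_algebra_def FactRing_def rcoset_mult_def ring.defs proj_def)
qed

lemma proj_alg_hom: "proj \<in> alg_hom K F Q"
  by (auto simp: alg_hom_def lin_hom_def carrier_Q Q_add Q_smult Q_mult Q_zero)

lemma Q_nonassoc_algebra: "nonassoc_algebra K Q"
proof (rule nonassoc_algebra_of_local_images)
  show "cring K" by (rule K.cring_axioms)
  show "\<zero>\<^bsub>Q\<^esub> \<in> carrier Q" by (simp add: Q_zero carrier_Q)
  show "nonassoc_algebra K F" by (rule free_nonassoc_algebra)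
  show "proj \<in> alg_hom K F Q" by (rule proj_alg_hom)
  fix x y z assume "x \<in> carrier Q" "y \<in> carrier Q" "z \<in> carrier Q"
  then show "\<exists>i::unit. {x, y, z} \<subseteq> proj ` carrier F" by (simp only: carrier_Q) blast
qed

sublocale Q: nonassoc_algebra K Q by (rule Q_nonassoc_algebra)

lemma lin_hom_constant_on_cosets:
  assumes h: "h \<in> lin_hom K F L" and L: "module K L"
    and "\<And>x. x \<in> X \<Longrightarrow> h x = \<zero>\<^bsub>L\<^esub>" and f: "f \<in> carrier F" and g: "g \<in> proj f"
  shows "h g = h f"
proof -
  interpret L: module K L by (rule L)
  have "{\<zero>\<^bsub>L\<^esub>} \<subseteq> carrier L" by simp
  then have 0: "submodule {\<zero>\<^bsub>L\<^esub>} K L" by (intro L.submoduleI) auto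
  have g': "g \<in> carrier F" using mem_projD[OF f g] by simp
  have "N \<subseteq> {f \<in> carrier F. h f \<in> {\<zero>\<^bsub>L\<^esub>}}"
    using assms(3) X_subset by (intro N_least kernel_submodule[OF h L 0]) auto
  then have "h (g \<ominus>\<^bsub>F\<^esub> f) = \<zero>\<^bsub>L\<^esub>" using g f g' mem_proj_iff by auto
  then have 0: "h g \<ominus>\<^bsub>L\<^esub> h f = \<zero>\<^bsub>L\<^esub>" using lin_hom_minus[OF h free_module L g' f] by simp
  have c: "h f \<in> carrier L" "h g \<in> carrier L" using lin_homD(1)[OF h] f g' by auto
  then have "h g = (h g \<ominus>\<^bsub>L\<^esub> h f) \<oplus>\<^bsub>L\<^esub> h f" by (simp add: L.M.minus_eq L.M.a_assoc L.M.l_neg)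
  with 0 c show ?thesis by simp
qed

lemma alg_hom_from_quotient:
  assumes h: "h \<in> alg_hom K F L" and \<phi>: "\<And>f. f \<in> carrier F \<Longrightarrow> \<phi> (proj f) = h f"
  shows "\<phi> \<in> alg_hom K Q L"
  using alg_homD(2-)[OF h]
  by (auto simp: alg_hom_def lin_hom_def carrier_Q Q_add Q_smult Q_mult Q_zero \<phi>)

end

section \<open>Tensor products\<close>

text \<open>Multiplying a bilinearity relation by a pure tensor \<open>(c, d)\<close> multiplies its entries by \<open>c\<close> and
  \<open>d\<close>, which by bilinearity of the two products is a relation of the same kind.\<close>

lemma tensor_presented:
  assumes A: "nonassoc_algebra K A" and B: "nonassoc_algebra K B"
  shows "presented_algebra K (A \<times>\<times> B) (tensor_rels K A B)"
proof -
  interpret A: nonassoc_algebra K A by (rule A)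
  interpret B: nonassoc_algebra K B by (rule B)
  interpret free_magma_algebra K "A \<times>\<times> B"
    by unfold_locales (auto simp: DirProd_def)
  let ?\<delta> = "single K" and ?X = "tensor_rels K A B"
  have I: "a \<in> carrier A \<Longrightarrow> a' \<in> carrier A \<Longrightarrow> b \<in> carrier B \<Longrightarrow>
        ?\<delta> (a \<oplus>\<^bsub>A\<^esub> a', b) \<ominus>\<^bsub>F\<^esub> (?\<delta> (a, b) \<oplus>\<^bsub>F\<^esub> ?\<delta> (a', b)) \<in> ?X"
    "a \<in> carrier A \<Longrightarrow> b \<in> carrier B \<Longrightarrow> b' \<in> carrier B \<Longrightarrow>
        ?\<delta> (a, b \<oplus>\<^bsub>B\<^esub> b') \<ominus>\<^bsub>F\<^esub> (?\<delta> (a, b) \<oplus>\<^bsub>F\<^esub> ?\<delta> (a, b')) \<in> ?X"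
    "k \<in> carrier K \<Longrightarrow> a \<in> carrier A \<Longrightarrow> b \<in> carrier B \<Longrightarrow>
        ?\<delta> (k \<odot>\<^bsub>A\<^esub> a, b) \<ominus>\<^bsub>F\<^esub> k \<odot>\<^bsub>F\<^esub> ?\<delta> (a, b) \<in> ?X"
    "k \<in> carrier K \<Longrightarrow> a \<in> carrier A \<Longrightarrow> b \<in> carrier B \<Longrightarrow>
        ?\<delta> (a, k \<odot>\<^bsub>B\<^esub> b) \<ominus>\<^bsub>F\<^esub> k \<odot>\<^bsub>F\<^esub> ?\<delta> (a, b) \<in> ?X" for a a' b b' k
    unfolding tensor_rels_def Let_def by blast+
  have carrier: "carrier (A \<times>\<times> B) = carrier A \<times> carrier B"
    by (simp add: DirProd_def)
  have mem: "?\<delta> (a, b) \<in> carrier F" if "a \<in> carrier A" "b \<in> carrier B" for a b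
    using that by (intro single_closed) (auto simp: DirProd_def)
  have mult: "?\<delta> (a, b) \<otimes>\<^bsub>F\<^esub> ?\<delta> (c, d) = ?\<delta> (a \<otimes>\<^bsub>A\<^esub> c, b \<otimes>\<^bsub>B\<^esub> d)"
    if "a \<in> carrier A" "b \<in> carrier B" "c \<in> carrier A" "d \<in> carrier B" for a b c d
    using that by (subst single_mult) (auto simp: DirProd_def)
  note simps = mem mult F.minus_mult F.mult_minus F.add_mult F.mult_add F.smult_mult F.mult_smult
    A.add_mult A.mult_add A.smult_mult A.mult_smult B.add_mult B.mult_add B.smult_mult B.mult_smult I
  show ?thesis
  proof unfold_locales
    have "?X \<subseteq> carrier F \<and> (\<forall>x\<in>?X. \<forall>s\<in>carrier (A \<times>\<times> B). x \<otimes>\<^bsub>F\<^esub> ?\<delta> s \<in> ?X \<and> ?\<delta> s \<otimes>\<^bsub>F\<^esub> x \<in> ?X)"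
    proof -
      have "x \<in> carrier F \<and> (\<forall>s\<in>carrier (A \<times>\<times> B). x \<otimes>\<^bsub>F\<^esub> ?\<delta> s \<in> ?X \<and> ?\<delta> s \<otimes>\<^bsub>F\<^esub> x \<in> ?X)"
        if "x \<in> ?X" for x
        using that
        apply (subst (asm) tensor_rels_def)
        unfolding Let_def Un_iff mem_Collect_eq
        by (elim disjE exE conjE) (simp_all add: carrier simps)
      then show ?thesis by blast
    qed
    then show "?X \<subseteq> carrier F"
      "\<And>x s. x \<in> ?X \<Longrightarrow> s \<in> carrier (A \<times>\<times> B) \<Longrightarrow> x \<otimes>\<^bsub>F\<^esub> ?\<delta> s \<in> ?X"
      "\<And>x s. x \<in> ?X \<Longrightarrow> s \<in> carrier (A \<times>\<times> B) \<Longrightarrow> ?\<delta> s \<otimes>\<^bsub>F\<^esub> x \<in> ?X"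
      by blast+
  qed
qed

lemma multi_tensor_presented:
  assumes K: "cring K" and B: "\<And>i. nonassoc_algebra K (B i)"
  shows "presented_algebra K (product_group I B) (multi_tensor_rels K I B)"
proof -
  interpret K: cring K by (rule K)
  interpret B: nonassoc_algebra K "B i" for i by (rule B)
  interpret free_magma_algebra K "product_group I B"
    by unfold_locales auto
  let ?\<delta> = "single K" and ?X = "multi_tensor_rels K I B" and ?P = "\<Pi>\<^sub>E i\<in>I. carrier (B i)"
  have R: "t \<in> ?P \<Longrightarrow> i \<in> I \<Longrightarrow> x \<in> carrier (B i) \<Longrightarrow> y \<in> carrier (B i) \<Longrightarrow>
        ?\<delta> (t(i := x \<oplus>\<^bsub>B i\<^esub> y)) \<ominus>\<^bsub>F\<^esub> (?\<delta> (t(i := x)) \<oplus>\<^bsub>F\<^esub> ?\<delta> (t(i := y))) \<in> ?X"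
    "t \<in> ?P \<Longrightarrow> i \<in> I \<Longrightarrow> k \<in> carrier K \<Longrightarrow> x \<in> carrier (B i) \<Longrightarrow>
        ?\<delta> (t(i := k \<odot>\<^bsub>B i\<^esub> x)) \<ominus>\<^bsub>F\<^esub> k \<odot>\<^bsub>F\<^esub> ?\<delta> (t(i := x)) \<in> ?X" for t i x y k
    unfolding multi_tensor_rels_def Let_def by blast+
  have upd: "t(i := x) \<in> ?P" if "t \<in> ?P" "i \<in> I" "x \<in> carrier (B i)" for t i x
    using that by (auto simp: PiE_iff extensional_def)
  have prd: "(\<lambda>j\<in>I. t j \<otimes>\<^bsub>B j\<^esub> s j) \<in> ?P" if "t \<in> ?P" "s \<in> ?P" for t s
    using that by auto
  have mem: "?\<delta> t \<in> carrier F" if "t \<in> ?P" for t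
    using that by auto
  have mult: "?\<delta> (t(i := x)) \<otimes>\<^bsub>F\<^esub> ?\<delta> s = ?\<delta> ((\<lambda>j\<in>I. t j \<otimes>\<^bsub>B j\<^esub> s j)(i := x \<otimes>\<^bsub>B i\<^esub> s i))"
    "?\<delta> s \<otimes>\<^bsub>F\<^esub> ?\<delta> (t(i := x)) = ?\<delta> ((\<lambda>j\<in>I. s j \<otimes>\<^bsub>B j\<^esub> t j)(i := s i \<otimes>\<^bsub>B i\<^esub> x))"
    if "t \<in> ?P" "s \<in> ?P" "i \<in> I" "x \<in> carrier (B i)" for t s i x
  proof -
    have u: "t(i := x) \<in> carrier (product_group I B)" "s \<in> carrier (product_group I B)"
      using upd[of t i x] that by auto
    have "(\<lambda>j\<in>I. (t(i := x)) j \<otimes>\<^bsub>B j\<^esub> s j) = (\<lambda>j\<in>I. t j \<otimes>\<^bsub>B j\<^esub> s j)(i := x \<otimes>\<^bsub>B i\<^esub> s i)"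
      "(\<lambda>j\<in>I. s j \<otimes>\<^bsub>B j\<^esub> (t(i := x)) j) = (\<lambda>j\<in>I. s j \<otimes>\<^bsub>B j\<^esub> t j)(i := s i \<otimes>\<^bsub>B i\<^esub> x)"
      using that(3) by (auto simp: fun_eq_iff restrict_def)
    then show "?\<delta> (t(i := x)) \<otimes>\<^bsub>F\<^esub> ?\<delta> s = ?\<delta> ((\<lambda>j\<in>I. t j \<otimes>\<^bsub>B j\<^esub> s j)(i := x \<otimes>\<^bsub>B i\<^esub> s i))"
      "?\<delta> s \<otimes>\<^bsub>F\<^esub> ?\<delta> (t(i := x)) = ?\<delta> ((\<lambda>j\<in>I. s j \<otimes>\<^bsub>B j\<^esub> t j)(i := s i \<otimes>\<^bsub>B i\<^esub> x))"
      using single_mult[OF u] single_mult[OF u(2,1)] by simp_all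
  qed
  have sB: "s i \<in> carrier (B i)" if "s \<in> ?P" "i \<in> I" for s i using that by auto
  note simps = mem mult upd prd sB F.minus_mult F.mult_minus F.add_mult F.mult_add F.smult_mult F.mult_smult
    B.add_mult B.mult_add B.smult_mult B.mult_smult R
  have *: "x \<in> carrier F \<and> (\<forall>s\<in>?P. x \<otimes>\<^bsub>F\<^esub> ?\<delta> s \<in> ?X \<and> ?\<delta> s \<otimes>\<^bsub>F\<^esub> x \<in> ?X)"
    if "x \<in> ?X" for x
    using that
    apply (subst (asm) multi_tensor_rels_def)
    unfolding Let_def Un_iff mem_Collect_eq
    by (elim disjE exE conjE) (simp_all add: simps)
  show ?thesis
  proof unfold_locales
    show "?X \<subseteq> carrier F"
      "\<And>x s. x \<in> ?X \<Longrightarrow> s \<in> carrier (product_group I B) \<Longrightarrow> x \<otimes>\<^bsub>F\<^esub> ?\<delta> s \<in> ?X"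
      "\<And>x s. x \<in> ?X \<Longrightarrow> s \<in> carrier (product_group I B) \<Longrightarrow> ?\<delta> s \<otimes>\<^bsub>F\<^esub> x \<in> ?X"
      using * by (auto simp only: carrier_product_group)
  qed
qed

section \<open>Direct limits\<close>

lemma alg_hom_compose: "h \<in> alg_hom K M L \<Longrightarrow> h' \<in> alg_hom K L P \<Longrightarrow> (\<lambda>x. h' (h x)) \<in> alg_hom K M P"
  by (auto simp: alg_hom_def lin_hom_def)

locale algebra_sequence =
  fixes K :: "('k, 'm) ring_scheme" and T :: "nat \<Rightarrow> ('k, 'a, 'n) module_scheme" and \<phi> :: "nat \<Rightarrow> 'a \<Rightarrow> 'a"
  assumes T_algebra: "nonassoc_algebra K (T n)"
    and step_hom: "\<phi> n \<in> alg_hom K (T n) (T (Suc n))"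
begin

abbreviation "tr \<equiv> trans_map \<phi>"
abbreviation "L \<equiv> direct_limit T \<phi>"

definition cls :: "nat \<Rightarrow> 'a \<Rightarrow> (nat \<times> 'a) set" where
  "cls n x = limit_rel T \<phi> `` {(n, x)}"

lemma tr_hom: "m \<le> l \<Longrightarrow> tr m l \<in> alg_hom K (T m) (T l)"
proof -
  have "iter_map \<phi> m d \<in> alg_hom K (T m) (T (m + d))" for d
  proof (induction d)
    case 0 then show ?case by (simp add: alg_hom_def lin_hom_def)
  next
    case (Suc d) then show ?case using alg_hom_compose[OF Suc step_hom[of "m + d"]] by simp
  qed
  from this[of "l - m"] show "m \<le> l \<Longrightarrow> ?thesis" by (simp add: trans_map_def)
qed

lemma tr_self [simp]: "tr n n x = x"
  by (simp add: trans_map_def)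

lemma tr_Suc: "m \<le> l \<Longrightarrow> tr m (Suc l) x = \<phi> l (tr m l x)"
  by (simp add: trans_map_def Suc_diff_le)

lemma tr_tr: "m \<le> l \<Longrightarrow> l \<le> p \<Longrightarrow> tr l p (tr m l x) = tr m p x"
proof -
  assume ml: "m \<le> l" and "l \<le> p"
  then obtain d where "p = l + d" using le_Suc_ex by blast
  moreover have "tr l (l + d) (tr m l x) = tr m (l + d) x"
    using ml by (induction d) (simp_all add: tr_Suc)
  ultimately show ?thesis by simp
qed

lemma tr_closed: "m \<le> l \<Longrightarrow> x \<in> carrier (T m) \<Longrightarrow> tr m l x \<in> carrier (T l)"
  by (rule alg_homD(2)[OF tr_hom])

lemma limit_rel_iff: "((m, x), (n, y)) \<in> limit_rel T \<phi> \<longleftrightarrow>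
    x \<in> carrier (T m) \<and> y \<in> carrier (T n) \<and> (\<exists>l. m \<le> l \<and> n \<le> l \<and> tr m l x = tr n l y)"
  by (auto simp: limit_rel_def)

text \<open>Transitivity: two coincidences at stages \<open>l1\<close> and \<open>l2\<close> can be compared at the larger stage.\<close>

lemma limit_rel_equiv: "equiv (SIGMA n:UNIV. carrier (T n)) (limit_rel T \<phi>)"
proof (intro equivI refl_onI symI transI)
  show "limit_rel T \<phi> \<subseteq> (SIGMA n:UNIV. carrier (T n)) \<times> (SIGMA n:UNIV. carrier (T n))"
    by (auto simp: limit_rel_def)
next
  fix p assume "p \<in> (SIGMA n:UNIV. carrier (T n))"
  then show "(p, p) \<in> limit_rel T \<phi>" by (auto simp: limit_rel_iff)
next
  fix p q assume "(p, q) \<in> limit_rel T \<phi>"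
  then show "(q, p) \<in> limit_rel T \<phi>" by (cases p; cases q) (auto simp: limit_rel_iff intro: sym)
next
  fix p q r assume pq: "(p, q) \<in> limit_rel T \<phi>" and qr: "(q, r) \<in> limit_rel T \<phi>"
  obtain m x n y k z where [simp]: "p = (m, x)" "q = (n, y)" "r = (k, z)"
    by (metis surj_pair)
  obtain l1 l2 where l1: "m \<le> l1" "n \<le> l1" "tr m l1 x = tr n l1 y"
    and l2: "n \<le> l2" "k \<le> l2" "tr n l2 y = tr k l2 z"
    using pq qr by (auto simp: limit_rel_iff)
  let ?l = "max l1 l2"
  have "tr m ?l x = tr l1 ?l (tr n l1 y)" using l1 by (simp add: tr_tr flip: l1(3))
  also have "\<dots> = tr l2 ?l (tr n l2 y)" using l1(1,2) l2(1,2) by (simp add: tr_tr)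
  also have "\<dots> = tr k ?l z" unfolding l2(3) using l2 by (simp add: tr_tr)
  finally show "(p, r) \<in> limit_rel T \<phi>"
    using pq qr l1 l2 by (auto simp: limit_rel_iff intro!: exI[of _ ?l])
qed

lemma carrier_L: "carrier L = {cls n x | n x. x \<in> carrier (T n)}"
  by (auto simp: direct_limit_def cls_def quotient_def)

lemma cls_tr:
  assumes "m \<le> l" "x \<in> carrier (T m)"
  shows "cls l (tr m l x) = cls m x"
proof -
  have "((m, x), (l, tr m l x)) \<in> limit_rel T \<phi>"
    using assms by (auto simp: limit_rel_iff tr_closed intro!: exI[of _ l])
  then show ?thesis unfolding cls_def by (rule equiv_class_eq[OF limit_rel_equiv, symmetric])
qed

lemma self_mem_cls: "x \<in> carrier (T n) \<Longrightarrow> (n, x) \<in> cls n x"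
  by (auto simp: cls_def limit_rel_iff)

lemma mem_clsD:
  assumes "(m, x') \<in> cls n x"
  shows "x' \<in> carrier (T m)" "\<exists>l. m \<le> l \<and> n \<le> l \<and> (\<forall>p\<ge>l. tr m p x' = tr n p x)"
proof -
  obtain l where l: "n \<le> l" "m \<le> l" "tr n l x = tr m l x'" and x': "x' \<in> carrier (T m)"
    using assms by (auto simp: cls_def limit_rel_iff)
  have "tr m p x' = tr n p x" if "l \<le> p" for p
    using l that by (metis tr_tr)
  with l x' show "x' \<in> carrier (T m)" "\<exists>l. m \<le> l \<and> n \<le> l \<and> (\<forall>p\<ge>l. tr m p x' = tr n p x)"
    by blast+
qed

text \<open>Addition and multiplication of the limit are instances: whichever representatives are chosen,
  moving them to a stage where they agree with \<open>x\<close> and \<open>y\<close> yields the class of \<open>f n x y\<close>, because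
  \<open>f\<close> commutes with the transition maps.\<close>

lemma cls_binop:
  fixes f :: "nat \<Rightarrow> 'a \<Rightarrow> 'a \<Rightarrow> 'a"
  assumes f: "\<And>l u v. u \<in> carrier (T l) \<Longrightarrow> v \<in> carrier (T l) \<Longrightarrow> f l u v \<in> carrier (T l)"
    and tr_f: "\<And>l p u v. l \<le> p \<Longrightarrow> u \<in> carrier (T l) \<Longrightarrow> v \<in> carrier (T l)
      \<Longrightarrow> tr l p (f l u v) = f p (tr l p u) (tr l p v)"
    and x: "x \<in> carrier (T n)" and y: "y \<in> carrier (T n)"
  shows "(\<Union>(i, x')\<in>cls n x. \<Union>(j, y')\<in>cls n y. let l = max i j in
    limit_rel T \<phi> `` {(l, f l (tr i l x') (tr j l y'))}) = cls n (f n x y)"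
proof -
  have "cls (max i j) (f (max i j) (tr i (max i j) x') (tr j (max i j) y')) = cls n (f n x y)"
    if i: "(i, x') \<in> cls n x" and j: "(j, y') \<in> cls n y" for i j x' y'
  proof -
    obtain l1 where l1: "i \<le> l1" "n \<le> l1" "\<And>p. l1 \<le> p \<Longrightarrow> tr i p x' = tr n p x"
      using mem_clsD(2)[OF i] by auto
    obtain l2 where l2: "j \<le> l2" "n \<le> l2" "\<And>p. l2 \<le> p \<Longrightarrow> tr j p y' = tr n p y"
      using mem_clsD(2)[OF j] by auto
    note x' = mem_clsD(1)[OF i] and y' = mem_clsD(1)[OF j]
    let ?m = "max i j" and ?p = "max l1 l2"
    have le: "?m \<le> ?p" "n \<le> ?p" using l1 l2 by auto
    have c: "tr i ?m x' \<in> carrier (T ?m)" "tr j ?m y' \<in> carrier (T ?m)"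
      using x' y' by (auto intro!: tr_closed)
    have "cls ?m (f ?m (tr i ?m x') (tr j ?m y')) = cls ?p (tr ?m ?p (f ?m (tr i ?m x') (tr j ?m y')))"
      using le c by (intro cls_tr[symmetric] f)
    also have "\<dots> = cls ?p (f ?p (tr i ?p x') (tr j ?p y'))"
      using le c by (simp add: tr_f tr_tr)
    also have "\<dots> = cls ?p (tr n ?p (f n x y))"
      using le x y l1(3)[of ?p] l2(3)[of ?p] by (simp add: tr_f)
    also have "\<dots> = cls n (f n x y)"
      using le x y by (intro cls_tr f)
    finally show ?thesis .
  qed
  then have "(\<Union>(i, x')\<in>cls n x. \<Union>(j, y')\<in>cls n y. let l = max i j in
      cls l (f l (tr i l x') (tr j l y'))) = (\<Union>p\<in>cls n x. \<Union>q\<in>cls n y. cls n (f n x y))"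
    by (intro SUP_cong refl) (auto simp: Let_def split: prod.splits)
  also have "\<dots> = cls n (f n x y)"
    using self_mem_cls[OF x] self_mem_cls[OF y] by blast
  finally show ?thesis unfolding cls_def .
qed

lemma cls_hom: "cls n \<in> alg_hom K (T n) L"
proof -
  have "cls n x \<oplus>\<^bsub>L\<^esub> cls n y = cls n (x \<oplus>\<^bsub>T n\<^esub> y)" if "x \<in> carrier (T n)" "y \<in> carrier (T n)" for x y
  proof -
    interpret T: nonassoc_algebra K "T l" for l by (rule T_algebra)
    show ?thesis
      using cls_binop[of "\<lambda>l. (\<oplus>\<^bsub>T l\<^esub>)", OF _ _ that] by (simp add: direct_limit_def alg_homD(3)[OF tr_hom])
  qed
  moreover have "cls n x \<otimes>\<^bsub>L\<^esub> cls n y = cls n (x \<otimes>\<^bsub>T n\<^esub> y)" if "x \<in> carrier (T n)" "y \<in> carrier (T n)" for x y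
  proof -
    interpret T: nonassoc_algebra K "T l" for l by (rule T_algebra)
    show ?thesis
      using cls_binop[of "\<lambda>l. (\<otimes>\<^bsub>T l\<^esub>)", OF _ _ that] by (simp add: direct_limit_def alg_homD(6)[OF tr_hom])
  qed
  moreover have "k \<odot>\<^bsub>L\<^esub> cls n x = cls n (k \<odot>\<^bsub>T n\<^esub> x)" if x: "x \<in> carrier (T n)" and k: "k \<in> carrier K" for x k
  proof -
    interpret T: nonassoc_algebra K "T l" for l by (rule T_algebra)
    have "cls m (k \<odot>\<^bsub>T m\<^esub> x') = cls n (k \<odot>\<^bsub>T n\<^esub> x)" if m: "(m, x') \<in> cls n x" for m x'
    proof -
      obtain l where l: "m \<le> l" "n \<le> l" "\<And>p. l \<le> p \<Longrightarrow> tr m p x' = tr n p x"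
        using mem_clsD(2)[OF m] by auto
      note x' = mem_clsD(1)[OF m]
      have "cls m (k \<odot>\<^bsub>T m\<^esub> x') = cls l (k \<odot>\<^bsub>T l\<^esub> tr m l x')"
        using cls_tr[OF l(1) T.smult_closed[OF k x']] alg_homD(4)[OF tr_hom[OF l(1)] k x'] by simp
      also have "\<dots> = cls n (k \<odot>\<^bsub>T n\<^esub> x)"
        using cls_tr[OF l(2) T.smult_closed[OF k x]] alg_homD(4)[OF tr_hom[OF l(2)] k x] l(3)[of l]
        by simp
      finally show ?thesis .
    qed
    then have "(\<Union>(m, x')\<in>cls n x. cls m (k \<odot>\<^bsub>T m\<^esub> x')) = (\<Union>p\<in>cls n x. cls n (k \<odot>\<^bsub>T n\<^esub> x))"
      by (intro SUP_cong refl) (auto split: prod.splits)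
    also have "\<dots> = cls n (k \<odot>\<^bsub>T n\<^esub> x)"
      using self_mem_cls[OF x] by blast
    finally show ?thesis by (simp add: direct_limit_def cls_def)
  qed
  moreover have "\<zero>\<^bsub>L\<^esub> = cls n \<zero>\<^bsub>T n\<^esub>"
  proof -
    interpret T: nonassoc_algebra K "T l" for l by (rule T_algebra)
    show ?thesis
      using cls_tr[of 0 n "\<zero>\<^bsub>T 0\<^esub>"] by (simp add: direct_limit_def cls_def alg_homD(5)[OF tr_hom])
  qed
  ultimately show ?thesis by (auto simp: alg_hom_def lin_hom_def carrier_L)
qed

lemma common_level:
  assumes "finite Y" "Y \<subseteq> carrier L"
  shows "\<exists>n. Y \<subseteq> cls n ` carrier (T n)"
  using assms
proof (induction Y)
  case empty then show ?case by simp
next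
  case (insert y Y)
  then obtain n m x where n: "Y \<subseteq> cls n ` carrier (T n)" and y: "y = cls m x" "x \<in> carrier (T m)"
    by (auto simp: carrier_L)
  have up: "cls i ` carrier (T i) \<subseteq> cls (max n m) ` carrier (T (max n m))" if "i \<le> max n m" for i
  proof safe
    fix z assume "z \<in> carrier (T i)"
    then show "cls i z \<in> cls (max n m) ` carrier (T (max n m))"
      using cls_tr[OF that] tr_closed[OF that] by (metis imageI)
  qed
  have "insert y Y \<subseteq> cls (max n m) ` carrier (T (max n m))"
    using n y up[of n] up[of m] by auto
  then show ?case by blast
qed

lemma limit_nonassoc_algebra: "nonassoc_algebra K L"
proof (rule nonassoc_algebra_of_local_images)
  interpret T: nonassoc_algebra K "T 0" by (rule T_algebra)
  show "cring K" by (rule T.R.is_cring)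
  show "\<zero>\<^bsub>L\<^esub> \<in> carrier L" using alg_homD(2)[OF cls_hom T.zero_closed] alg_homD(5)[OF cls_hom, of 0] by simp
  show "nonassoc_algebra K (T n)" for n by (rule T_algebra)
  show "cls n \<in> alg_hom K (T n) L" for n by (rule cls_hom)
  fix x y z assume "x \<in> carrier L" "y \<in> carrier L" "z \<in> carrier L"
  then show "\<exists>n. {x, y, z} \<subseteq> cls n ` carrier (T n)" by (intro common_level) auto
qed

end

section \<open>Finite tensor products and the connecting maps\<close>

locale unital_algebra_sequence =
  fixes K :: "('k, 'm) ring_scheme" and B :: "nat \<Rightarrow> ('k, 'b, 'p) module_scheme"
  assumes K_cring: "cring K" and B_algebra: "nonassoc_algebra K (B i)" and B_monoid: "Group.monoid (B i)"
begin

abbreviation "T I \<equiv> multi_tensor_algebra K I B"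
abbreviation "pure I \<equiv> pure_tensor K I B"
abbreviation "tuples I \<equiv> \<Pi>\<^sub>E i\<in>I. carrier (B i)"

sublocale B: nonassoc_algebra K "B i" for i by (rule B_algebra)
sublocale B: Group.monoid "B i" for i by (rule B_monoid)

lemma presented: "presented_algebra K (product_group I B) (multi_tensor_rels K I B)"
  by (rule multi_tensor_presented[OF K_cring B_algebra])

lemma T_algebra: "nonassoc_algebra K (T I)"
  unfolding multi_tensor_algebra_def multi_tensor_ideal_def
  by (rule presented_algebra.Q_nonassoc_algebra[OF presented])

sublocale T: nonassoc_algebra K "T I" for I by (rule T_algebra)

lemma pure_closed: "t \<in> tuples I \<Longrightarrow> pure I t \<in> carrier (T I)"
  and pure_mult: "t \<in> tuples I \<Longrightarrow> s \<in> tuples I \<Longrightarrow>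
    pure I t \<otimes>\<^bsub>T I\<^esub> pure I s = pure I (\<lambda>i\<in>I. t i \<otimes>\<^bsub>B i\<^esub> s i)"
  and pure_add: "t \<in> tuples I \<Longrightarrow> i \<in> I \<Longrightarrow> x \<in> carrier (B i) \<Longrightarrow> y \<in> carrier (B i) \<Longrightarrow>
    pure I (t(i := x \<oplus>\<^bsub>B i\<^esub> y)) = pure I (t(i := x)) \<oplus>\<^bsub>T I\<^esub> pure I (t(i := y))"
  and pure_smult: "t \<in> tuples I \<Longrightarrow> i \<in> I \<Longrightarrow> k \<in> carrier K \<Longrightarrow> x \<in> carrier (B i) \<Longrightarrow>
    pure I (t(i := k \<odot>\<^bsub>B i\<^esub> x)) = k \<odot>\<^bsub>T I\<^esub> pure I (t(i := x))"
proof -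
  interpret P: presented_algebra K "product_group I B" "multi_tensor_rels K I B" by (rule presented)
  have T: "T I = P.Q" by (simp add: multi_tensor_algebra_def multi_tensor_ideal_def)
  have p: "pure I t = P.proj (single K t)" for t
    by (simp add: pure_tensor_def multi_tensor_ideal_def P.proj_def)
  have upd: "t(i := x) \<in> tuples I" if "t \<in> tuples I" "i \<in> I" "x \<in> carrier (B i)" for t i x
    using that by (auto simp: PiE_iff extensional_def)
  have s: "single K t \<in> carrier P.F" if "t \<in> tuples I" for t using that by auto
  show "t \<in> tuples I \<Longrightarrow> pure I t \<in> carrier (T I)" for t
    unfolding T p P.carrier_Q using s by blast
  show "pure I t \<otimes>\<^bsub>T I\<^esub> pure I s = pure I (\<lambda>i\<in>I. t i \<otimes>\<^bsub>B i\<^esub> s i)" if "t \<in> tuples I" "s \<in> tuples I" for t s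
    unfolding T p using that P.single_mult[of t s] by (subst P.Q_mult) auto
  show "pure I (t(i := x \<oplus>\<^bsub>B i\<^esub> y)) = pure I (t(i := x)) \<oplus>\<^bsub>T I\<^esub> pure I (t(i := y))"
    if t: "t \<in> tuples I" "i \<in> I" "x \<in> carrier (B i)" "y \<in> carrier (B i)" for t i x y
  proof -
    have "single K (t(i := x \<oplus>\<^bsub>B i\<^esub> y)) \<ominus>\<^bsub>P.F\<^esub>
        (single K (t(i := x)) \<oplus>\<^bsub>P.F\<^esub> single K (t(i := y))) \<in> multi_tensor_rels K I B"
      unfolding multi_tensor_rels_def Let_def using t by blast
    then have "P.proj (single K (t(i := x \<oplus>\<^bsub>B i\<^esub> y))) =
        P.proj (single K (t(i := x)) \<oplus>\<^bsub>P.F\<^esub> single K (t(i := y)))"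
      using P.X_subset_N t by (intro P.proj_eqI P.F.M.a_closed s upd) auto
    then show ?thesis using t by (simp only: T p P.Q_add s upd)
  qed
  show "pure I (t(i := k \<odot>\<^bsub>B i\<^esub> x)) = k \<odot>\<^bsub>T I\<^esub> pure I (t(i := x))"
    if t: "t \<in> tuples I" "i \<in> I" "k \<in> carrier K" "x \<in> carrier (B i)" for t i k x
  proof -
    have "single K (t(i := k \<odot>\<^bsub>B i\<^esub> x)) \<ominus>\<^bsub>P.F\<^esub> k \<odot>\<^bsub>P.F\<^esub> single K (t(i := x)) \<in> multi_tensor_rels K I B"
      unfolding multi_tensor_rels_def Let_def using t by blast
    then have "P.proj (single K (t(i := k \<odot>\<^bsub>B i\<^esub> x))) = P.proj (k \<odot>\<^bsub>P.F\<^esub> single K (t(i := x)))"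
      using P.X_subset_N t by (intro P.proj_eqI P.F.smult_closed s upd) auto
    then show ?thesis using t by (simp only: T p P.Q_smult s upd)
  qed
qed

abbreviation "ext n t \<equiv> t(Suc n := \<one>\<^bsub>B (Suc n)\<^esub>)"

lemma tuples_upd: "t \<in> tuples I \<Longrightarrow> i \<in> I \<Longrightarrow> x \<in> carrier (B i) \<Longrightarrow> t(i := x) \<in> tuples I"
  by (auto simp: PiE_iff extensional_def)

lemma tuples_upd_Suc: "t \<in> tuples {..n} \<Longrightarrow> x \<in> carrier (B (Suc n)) \<Longrightarrow> t(Suc n := x) \<in> tuples {..Suc n}"
  by (auto simp: PiE_iff extensional_def)

abbreviation "step_lin n \<equiv> lin_ext K (T {..Suc n}) (\<lambda>t. pure {..Suc n} (ext n t))"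

lemma pure_ext_closed: "t \<in> carrier (product_group {..n} B) \<Longrightarrow> pure {..Suc n} (ext n t) \<in> carrier (T {..Suc n})"
  by (intro pure_closed tuples_upd_Suc) auto

lemma pure_ext_mult:
  assumes "s \<in> tuples {..n}" "t \<in> tuples {..n}"
  shows "pure {..Suc n} (ext n (\<lambda>i\<in>{..n}. s i \<otimes>\<^bsub>B i\<^esub> t i)) =
    pure {..Suc n} (ext n s) \<otimes>\<^bsub>T {..Suc n}\<^esub> pure {..Suc n} (ext n t)"
proof -
  have "ext n (\<lambda>i\<in>{..n}. s i \<otimes>\<^bsub>B i\<^esub> t i) = (\<lambda>i\<in>{..Suc n}. ext n s i \<otimes>\<^bsub>B i\<^esub> ext n t i)"
    by (auto simp: fun_eq_iff restrict_def le_Suc_eq)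
  then show ?thesis using assms by (simp add: pure_mult tuples_upd_Suc)
qed

lemma step_lin_hom: "step_lin n \<in> alg_hom K (free_algebra K (product_group {..n} B)) (T {..Suc n})"
proof -
  interpret P: presented_algebra K "product_group {..n} B" "multi_tensor_rels K {..n} B"
    by (rule presented)
  show ?thesis
    by (rule P.lin_ext_alg_hom[OF T_algebra pure_ext_closed])
      (simp_all only: mult_product_group carrier_product_group pure_ext_mult)
qed

text \<open>A relation of \<open>B 0 \<otimes> \<dots> \<otimes> B n\<close> involves a slot \<open>i \<le> n\<close>, and filling slot \<open>Suc n\<close> with \<open>1\<close> commutes
  with changing slot \<open>i\<close>. So the relation goes to the same relation one stage later. Hence the
  connecting map is well defined.\<close>

lemma step_lin_rel:
  assumes x: "x \<in> multi_tensor_rels K {..n} B"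
  shows "step_lin n x = \<zero>\<^bsub>T {..Suc n}\<^esub>"
proof -
  interpret P: presented_algebra K "product_group {..n} B" "multi_tensor_rels K {..n} B"
    by (rule presented)
  note hom = alg_homD[OF step_lin_hom[of n]]
  note minus = lin_hom_minus[OF hom(1) P.free_module T.module_axioms]
  have s: "single K t \<in> carrier P.F" if "t \<in> tuples {..n}" for t using that by auto
  have v: "step_lin n (single K t) = pure {..Suc n} (ext n t)" if "t \<in> tuples {..n}" for t
    using that by (intro P.lin_ext_single[OF T.module_axioms pure_ext_closed]) auto
  have c: "pure {..Suc n} (ext n t) \<in> carrier (T {..Suc n})" if "t \<in> tuples {..n}" for t
    using that by (intro pure_ext_closed) auto
  have swap: "ext n (t(i := z)) = (ext n t)(i := z)" if "i \<le> n" for t i z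
    using that by (auto simp: fun_eq_iff)
  show ?thesis
    using x unfolding multi_tensor_rels_def Let_def Un_iff mem_Collect_eq
  proof (elim disjE exE conjE)
    fix t i y z assume x: "x = single K (t(i := y \<oplus>\<^bsub>B i\<^esub> z)) \<ominus>\<^bsub>P.F\<^esub>
        (single K (t(i := y)) \<oplus>\<^bsub>P.F\<^esub> single K (t(i := z)))"
      and t: "t \<in> tuples {..n}" and i: "i \<in> {..n}" and y: "y \<in> carrier (B i)" and z: "z \<in> carrier (B i)"
    note u = tuples_upd[OF t i y] tuples_upd[OF t i z] tuples_upd[OF t i B.a_closed[OF y z]]
    have "pure {..Suc n} (ext n (t(i := y \<oplus>\<^bsub>B i\<^esub> z))) =
        pure {..Suc n} (ext n (t(i := y))) \<oplus>\<^bsub>T {..Suc n}\<^esub> pure {..Suc n} (ext n (t(i := z)))"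
      using i t y z by (simp add: swap pure_add tuples_upd_Suc)
    then show ?thesis
      using u by (simp add: x minus hom s v c T.M.minus_eq T.M.r_neg)
  next
    fix t i k y assume x: "x = single K (t(i := k \<odot>\<^bsub>B i\<^esub> y)) \<ominus>\<^bsub>P.F\<^esub> k \<odot>\<^bsub>P.F\<^esub> single K (t(i := y))"
      and t: "t \<in> tuples {..n}" and i: "i \<in> {..n}" and k: "k \<in> carrier K" and y: "y \<in> carrier (B i)"
    note u = tuples_upd[OF t i y] tuples_upd[OF t i B.smult_closed[OF k y]]
    have "pure {..Suc n} (ext n (t(i := k \<odot>\<^bsub>B i\<^esub> y))) =
        k \<odot>\<^bsub>T {..Suc n}\<^esub> pure {..Suc n} (ext n (t(i := y)))"
      using i t y k by (simp add: swap pure_smult tuples_upd_Suc)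
    then show ?thesis
      using u k by (simp add: x minus hom s v c T.M.minus_eq T.M.r_neg)
  qed
qed

lemma tensor_step_coset:
  assumes f: "f \<in> carrier (free_algebra K (product_group {..n} B))"
  shows "tensor_step K B n (multi_tensor_ideal K {..n} B +>\<^bsub>free_algebra K (product_group {..n} B)\<^esub> f) = step_lin n f"
proof -
  interpret P: presented_algebra K "product_group {..n} B" "multi_tensor_rels K {..n} B"
    by (rule presented)
  have "step_lin n g = step_lin n f" if "g \<in> P.proj f" for g
    by (rule P.lin_hom_constant_on_cosets[OF alg_homD(1)[OF step_lin_hom] T.module_axioms step_lin_rel f that])
  then have "step_lin n ` P.proj f = (\<lambda>_. step_lin n f) ` P.proj f" by (rule image_cong[OF refl])
  also have "\<dots> = {step_lin n f}" by (rule image_constant[OF P.self_mem_proj[OF f]])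
  finally have "step_lin n ` P.proj f = {step_lin n f}" .
  then show ?thesis
    by (simp add: tensor_step_def Let_def multi_tensor_ideal_def P.proj_def lin_ext_def)
qed

lemma tensor_step_hom: "tensor_step K B n \<in> alg_hom K (T {..n}) (T {..Suc n})"
proof -
  interpret P: presented_algebra K "product_group {..n} B" "multi_tensor_rels K {..n} B"
    by (rule presented)
  have "tensor_step K B n \<in> alg_hom K P.Q (T {..Suc n})"
    using tensor_step_coset
    by (intro P.alg_hom_from_quotient[OF step_lin_hom]) (simp add: P.proj_def multi_tensor_ideal_def)
  then show ?thesis by (simp add: multi_tensor_algebra_def multi_tensor_ideal_def)
qed

end

section \<open>Elements concentrated in one tensor factor\<close>

context unital_algebra_sequence
begin

sublocale S: algebra_sequence K "\<lambda>n. T {..n}" "tensor_step K B"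
  by (intro algebra_sequence.intro T_algebra tensor_step_hom)

lemma infinite_tensor_algebra_eq: "infinite_tensor_algebra K B = S.L"
  by (simp add: infinite_tensor_algebra_def)

abbreviation "slot n x \<equiv> pure {..Suc n} ((\<lambda>i\<in>{..Suc n}. \<one>\<^bsub>B i\<^esub>)(Suc n := x))"

lemma slot_closed: "x \<in> carrier (B (Suc n)) \<Longrightarrow> slot n x \<in> carrier (T {..Suc n})"
  by (intro pure_closed tuples_upd) auto

text \<open>The heart of the argument. An element of \<open>B 0 \<otimes> \<dots> \<otimes> B n\<close> has entry \<open>1\<close> in slot \<open>Suc n\<close> after the
  connecting map, while \<open>slot n x\<close> and \<open>slot n y\<close> have entry \<open>1\<close> in all other slots. On a pure
  tensor the product is therefore computed in \<open>B (Suc n)\<close> alone and turns \<open>1\<close> into \<open>x 1 y = k 1\<close>.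
  The scalar \<open>k\<close> covers the two cases \<open>x 1 y = 1\<close> and \<open>x 1 y = 0\<close> of proper infiniteness at once.\<close>

lemma slot_mult_step_mult_slot:
  assumes x: "x \<in> carrier (B (Suc n))" and y: "y \<in> carrier (B (Suc n))" and k: "k \<in> carrier K"
    and xy: "x \<otimes>\<^bsub>B (Suc n)\<^esub> \<one>\<^bsub>B (Suc n)\<^esub> \<otimes>\<^bsub>B (Suc n)\<^esub> y = k \<odot>\<^bsub>B (Suc n)\<^esub> \<one>\<^bsub>B (Suc n)\<^esub>"
    and b: "b \<in> carrier (T {..n})"
  shows "slot n x \<otimes>\<^bsub>T {..Suc n}\<^esub> tensor_step K B n b \<otimes>\<^bsub>T {..Suc n}\<^esub> slot n y =
    k \<odot>\<^bsub>T {..Suc n}\<^esub> tensor_step K B n b"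
proof -
  interpret P: presented_algebra K "product_group {..n} B" "multi_tensor_rels K {..n} B"
    by (rule presented)
  obtain f where f: "f \<in> carrier P.F" and b: "b = P.proj f"
    using b by (auto simp: multi_tensor_algebra_def multi_tensor_ideal_def P.carrier_Q)
  have step: "tensor_step K B n b = step_lin n f"
    using tensor_step_coset[OF f] by (simp add: b P.proj_def multi_tensor_ideal_def)
  note hom = alg_homD[OF step_lin_hom[of n]]
  let ?U = "T {..Suc n}"
  note sc = slot_closed[OF x] slot_closed[OF y]
  have on_pure: "slot n x \<otimes>\<^bsub>?U\<^esub> pure {..Suc n} (ext n t) \<otimes>\<^bsub>?U\<^esub> slot n y = k \<odot>\<^bsub>?U\<^esub> pure {..Suc n} (ext n t)"
    if t: "t \<in> tuples {..n}" for t
  proof -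
    let ?e = "\<lambda>x. (\<lambda>i\<in>{..Suc n}. \<one>\<^bsub>B i\<^esub>)(Suc n := x)"
    have e: "?e z \<in> tuples {..Suc n}" if "z \<in> carrier (B (Suc n))" for z
      using that by (intro tuples_upd) auto
    have t': "ext n t \<in> tuples {..Suc n}" using t by (intro tuples_upd_Suc) auto
    have tm: "i \<le> n \<Longrightarrow> t i \<in> carrier (B i)" and tu: "n < i \<Longrightarrow> t i = undefined" for i
      using t by (auto simp: PiE_iff extensional_def)
    have p1: "(\<lambda>i\<in>{..Suc n}. ?e x i \<otimes>\<^bsub>B i\<^esub> ext n t i) = t(Suc n := x \<otimes>\<^bsub>B (Suc n)\<^esub> \<one>\<^bsub>B (Suc n)\<^esub>)"
      using tm tu by (auto simp: fun_eq_iff restrict_def le_Suc_eq)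
    have p2: "(\<lambda>i\<in>{..Suc n}. (t(Suc n := x \<otimes>\<^bsub>B (Suc n)\<^esub> \<one>\<^bsub>B (Suc n)\<^esub>)) i \<otimes>\<^bsub>B i\<^esub> ?e y i) =
        t(Suc n := k \<odot>\<^bsub>B (Suc n)\<^esub> \<one>\<^bsub>B (Suc n)\<^esub>)"
      using tm tu xy by (auto simp: fun_eq_iff restrict_def le_Suc_eq)
    have t1: "t(Suc n := x \<otimes>\<^bsub>B (Suc n)\<^esub> \<one>\<^bsub>B (Suc n)\<^esub>) \<in> tuples {..Suc n}"
      using t x by (intro tuples_upd_Suc) auto
    have "slot n x \<otimes>\<^bsub>?U\<^esub> pure {..Suc n} (ext n t) \<otimes>\<^bsub>?U\<^esub> slot n y =
        pure {..Suc n} (t(Suc n := k \<odot>\<^bsub>B (Suc n)\<^esub> \<one>\<^bsub>B (Suc n)\<^esub>))"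
      by (simp only: pure_mult[OF e[OF x] t'] p1 pure_mult[OF t1 e[OF y]] p2)
    also have "\<dots> = k \<odot>\<^bsub>?U\<^esub> pure {..Suc n} (ext n t)"
      using pure_smult[OF t', of "Suc n" k "\<one>\<^bsub>B (Suc n)\<^esub>"] k by simp
    finally show ?thesis .
  qed
  have "slot n x \<otimes>\<^bsub>?U\<^esub> step_lin n f \<otimes>\<^bsub>?U\<^esub> slot n y = k \<odot>\<^bsub>?U\<^esub> step_lin n f"
  proof (rule P.lin_hom_eqI[OF _ _ f])
    show "(\<lambda>f. slot n x \<otimes>\<^bsub>?U\<^esub> step_lin n f \<otimes>\<^bsub>?U\<^esub> slot n y) \<in> lin_hom K P.F ?U"
      using sc by (auto simp: lin_hom_def hom T.mult_add T.add_mult T.mult_smult T.smult_mult)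
    show "(\<lambda>f. k \<odot>\<^bsub>?U\<^esub> step_lin n f) \<in> lin_hom K P.F ?U"
      using k by (auto simp: lin_hom_def hom T.smult_r_distr B.R.m_comm simp flip: T.smult_assoc1)
    fix t assume t: "t \<in> carrier (product_group {..n} B)"
    have "step_lin n (single K t) = pure {..Suc n} (ext n t)"
      by (rule P.lin_ext_single[OF T.module_axioms pure_ext_closed t])
    then show "slot n x \<otimes>\<^bsub>?U\<^esub> step_lin n (single K t) \<otimes>\<^bsub>?U\<^esub> slot n y = k \<odot>\<^bsub>?U\<^esub> step_lin n (single K t)"
      using on_pure[of t] t by simp
  qed
  then show ?thesis by (simp only: step)
qed

lemma cls_slot_scaling:
  assumes x: "x \<in> carrier (B (Suc n))" and y: "y \<in> carrier (B (Suc n))" and k: "k \<in> carrier K"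
    and xy: "x \<otimes>\<^bsub>B (Suc n)\<^esub> \<one>\<^bsub>B (Suc n)\<^esub> \<otimes>\<^bsub>B (Suc n)\<^esub> y = k \<odot>\<^bsub>B (Suc n)\<^esub> \<one>\<^bsub>B (Suc n)\<^esub>"
    and b: "b \<in> S.cls n ` carrier (T {..n})"
  shows "S.cls (Suc n) (slot n x) \<otimes>\<^bsub>S.L\<^esub> b \<otimes>\<^bsub>S.L\<^esub> S.cls (Suc n) (slot n y) = k \<odot>\<^bsub>S.L\<^esub> b"
proof -
  obtain z where z: "z \<in> carrier (T {..n})" "b = S.cls n z" using b by auto
  have b': "b = S.cls (Suc n) (tensor_step K B n z)"
    using S.cls_tr[of n "Suc n" z] z S.tr_Suc[of n n z] by simp
  note hom = alg_homD[OF S.cls_hom[of "Suc n"]]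
  have c: "tensor_step K B n z \<in> carrier (T {..Suc n})" using z(1) by (rule alg_homD(2)[OF tensor_step_hom])
  show ?thesis
    using slot_mult_step_mult_slot[OF x y k xy z(1)] slot_closed[OF x] slot_closed[OF y] c k
    by (simp add: b' flip: hom(4) hom(6))
qed

end

section \<open>Local units\<close>

text \<open>Local units for finite sets (Tominaga): if \<open>u\<close> fixes \<open>Y\<close> and \<open>w\<close> fixes \<open>x - u x\<close>, then
  \<open>v = w - w u + u\<close> satisfies \<open>v a = w (a - u a) + u a\<close> for every \<open>a\<close>. For \<open>a \<in> Y\<close> the first term
  vanishes, and for \<open>a = x\<close> it is \<open>x - u x\<close>.\<close>

lemma s_unital_finite_left:
  assumes A: "k_algebra K A" and s: "s_unital A" and "finite Y" "Y \<subseteq> carrier A"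
  shows "\<exists>u\<in>carrier A. \<forall>a\<in>Y. u \<otimes>\<^bsub>A\<^esub> a = a"
  using assms(3,4)
proof (induction Y)
  case empty
  interpret nonassoc_algebra K A by (rule k_algebra_imp_nonassoc_algebra[OF A])
  show ?case by auto
next
  case (insert x Y)
  interpret nonassoc_algebra K A by (rule k_algebra_imp_nonassoc_algebra[OF A])
  have assoc: "a \<otimes>\<^bsub>A\<^esub> b \<otimes>\<^bsub>A\<^esub> c = a \<otimes>\<^bsub>A\<^esub> (b \<otimes>\<^bsub>A\<^esub> c)"
    if "a \<in> carrier A" "b \<in> carrier A" "c \<in> carrier A" for a b c
    using A that by (auto simp: k_algebra_def)
  obtain u where u: "u \<in> carrier A" "\<And>a. a \<in> Y \<Longrightarrow> u \<otimes>\<^bsub>A\<^esub> a = a" using insert by auto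
  have x: "x \<in> carrier A" using insert by simp
  obtain w where w: "w \<in> carrier A" "w \<otimes>\<^bsub>A\<^esub> (x \<ominus>\<^bsub>A\<^esub> u \<otimes>\<^bsub>A\<^esub> x) = x \<ominus>\<^bsub>A\<^esub> u \<otimes>\<^bsub>A\<^esub> x"
    using s x u(1) by (auto simp: s_unital_def)
  define v where "v = (w \<ominus>\<^bsub>A\<^esub> w \<otimes>\<^bsub>A\<^esub> u) \<oplus>\<^bsub>A\<^esub> u"
  have v: "v \<in> carrier A" using w u by (simp add: v_def)
  have va: "v \<otimes>\<^bsub>A\<^esub> a = w \<otimes>\<^bsub>A\<^esub> (a \<ominus>\<^bsub>A\<^esub> u \<otimes>\<^bsub>A\<^esub> a) \<oplus>\<^bsub>A\<^esub> u \<otimes>\<^bsub>A\<^esub> a" if "a \<in> carrier A" for a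
    using that u(1) w(1) by (simp add: v_def add_mult minus_mult mult_minus assoc)
  have "v \<otimes>\<^bsub>A\<^esub> x = x"
    using va[OF x] w u(1) x by (simp add: M.minus_eq M.a_assoc M.l_neg)
  moreover have "v \<otimes>\<^bsub>A\<^esub> a = a" if "a \<in> Y" for a
    using va[of a] u(2)[OF that] w(1) insert.prems that by (auto simp: M.minus_eq M.r_neg)
  ultimately show ?case using v by blast
qed

lemma s_unital_finite_right:
  assumes A: "k_algebra K A" and s: "s_unital A" and "finite Y" "Y \<subseteq> carrier A"
  shows "\<exists>u\<in>carrier A. \<forall>a\<in>Y. a \<otimes>\<^bsub>A\<^esub> u = a"
proof -
  \<comment> \<open>the opposite algebra exchanges left and right units\<close>
  let ?O = "A\<lparr>monoid.mult := \<lambda>x y. y \<otimes>\<^bsub>A\<^esub> x\<rparr>"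
  have "module K ?O \<longleftrightarrow> module K A"
    by (simp add: module_def abelian_group_def abelian_monoid_def abelian_group_axioms_def module_axioms_def)
  moreover have "module K A" using A by (simp add: k_algebra_def)
  ultimately have "k_algebra K ?O"
    using A by (simp add: k_algebra_def)
  moreover have "s_unital ?O" using s by (auto simp: s_unital_def)
  ultimately show ?thesis using s_unital_finite_left[of K ?O Y] assms(3,4) by simp
qed

section \<open>Proper pure infiniteness\<close>

theorem theorem4p2:
  fixes K :: "'k ring"
    and A :: "('k, 'a) module"
    and B :: "nat \<Rightarrow> ('k, 'b) module"
  assumes "field K"
    and "k_algebra K A" and "s_unital A"
    and "\<And>i. unital_k_algebra K (B i)"
    and "\<And>i. properly_infinite (B i) \<one>\<^bsub>B i\<^esub>"
  shows "properly_purely_infinite (tensor_algebra K A (infinite_tensor_algebra K B))"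
proof -
  have B: "nonassoc_algebra K (B i)" "Group.monoid (B i)" for i
    using assms(4)[of i] k_algebra_imp_nonassoc_algebra by (auto simp: unital_k_algebra_def)
  interpret K: field K by (rule assms(1))
  interpret A: nonassoc_algebra K A by (rule k_algebra_imp_nonassoc_algebra[OF assms(2)])
  interpret U: unital_algebra_sequence K B
    by (rule unital_algebra_sequence.intro[OF K.is_cring B])
  let ?L = "infinite_tensor_algebra K B"
  interpret L: nonassoc_algebra K ?L
    unfolding U.infinite_tensor_algebra_eq by (rule U.S.limit_nonassoc_algebra)
  interpret P: presented_algebra K "A \<times>\<times> ?L" "tensor_rels K A ?L"
    by (rule tensor_presented[OF A.nonassoc_algebra_axioms L.nonassoc_algebra_axioms])
  have R: "tensor_algebra K A ?L = P.Q" by (simp add: tensor_algebra_def Let_def)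
  have pm: "carrier (A \<times>\<times> ?L) = carrier A \<times> carrier ?L"
    "(a, b) \<otimes>\<^bsub>A \<times>\<times> ?L\<^esub> (a', b') = (a \<otimes>\<^bsub>A\<^esub> a', b \<otimes>\<^bsub>?L\<^esub> b')" for a b a' b'
    by (simp_all add: DirProd_def)
  show ?thesis
    unfolding R properly_purely_infinite_def
  proof (intro ballI impI)
    fix r assume r: "r \<in> carrier P.Q" "r \<noteq> \<zero>\<^bsub>P.Q\<^esub>"
    obtain f where f: "f \<in> carrier P.F" and r_f: "r = P.proj f" using r(1) by (auto simp: P.carrier_Q)
    define Y where "Y = {p. f p \<noteq> \<zero>\<^bsub>K\<^esub>}"
    have Y: "finite Y" "Y \<subseteq> carrier A \<times> carrier ?L"
      using P.support_finite[OF f] P.support_subset[OF f] by (simp_all add: Y_def pm)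
    have Y1: "finite (fst ` Y)" "fst ` Y \<subseteq> carrier A" "finite (snd ` Y)" "snd ` Y \<subseteq> carrier ?L"
      using Y by auto
    obtain u where u: "u \<in> carrier A" "\<And>p. p \<in> Y \<Longrightarrow> u \<otimes>\<^bsub>A\<^esub> fst p = fst p"
      using s_unital_finite_left[OF assms(2,3) Y1(1,2)] by auto
    obtain v where v: "v \<in> carrier A" "\<And>p. p \<in> Y \<Longrightarrow> fst p \<otimes>\<^bsub>A\<^esub> v = fst p"
      using s_unital_finite_right[OF assms(2,3) Y1(1,2)] by auto
    obtain n where n: "snd ` Y \<subseteq> U.S.cls n ` carrier (U.T {..n})"
      using U.S.common_level[OF Y1(3)] Y1(4) by (auto simp: U.infinite_tensor_algebra_eq)
    \<comment> \<open>one stage after \<open>n\<close>, all \<open>snd p\<close> with \<open>p \<in> Y\<close> have entry \<open>1\<close> in the factor \<open>B (Suc n)\<close>\<close>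
    let ?s = "\<lambda>x. U.S.cls (Suc n) (U.slot n x)"
    have s: "?s x \<in> carrier ?L" if "x \<in> carrier (B (Suc n))" for x
      unfolding U.infinite_tensor_algebra_eq using U.slot_closed[OF that] by (rule alg_homD(2)[OF U.S.cls_hom])
    define \<alpha> where "\<alpha> x = P.proj (single K (u, ?s x))" for x
    define \<beta> where "\<beta> y = P.proj (single K (v, ?s y))" for y
    have ab: "\<alpha> x \<in> carrier P.Q" "\<beta> x \<in> carrier P.Q" if "x \<in> carrier (B (Suc n))" for x
      using s[OF that] u(1) v(1) by (auto simp: \<alpha>_def \<beta>_def P.carrier_Q pm)
    \<comment> \<open>on \<open>a \<otimes> b\<close>: \<open>u a v = a\<close> in the first factor, and the second factor is scaled by \<open>k\<close>\<close>
    have scale: "\<alpha> x \<otimes>\<^bsub>P.Q\<^esub> r \<otimes>\<^bsub>P.Q\<^esub> \<beta> y = k \<odot>\<^bsub>P.Q\<^esub> r"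
      if x: "x \<in> carrier (B (Suc n))" and y: "y \<in> carrier (B (Suc n))" and k: "k \<in> carrier K"
        and xy: "x \<otimes>\<^bsub>B (Suc n)\<^esub> \<one>\<^bsub>B (Suc n)\<^esub> \<otimes>\<^bsub>B (Suc n)\<^esub> y = k \<odot>\<^bsub>B (Suc n)\<^esub> \<one>\<^bsub>B (Suc n)\<^esub>" for x y k
      unfolding r_f
    proof (rule P.lin_hom_eqI[OF _ _ f])
      note hom = alg_homD[OF P.proj_alg_hom]
      show "(\<lambda>f. \<alpha> x \<otimes>\<^bsub>P.Q\<^esub> P.proj f \<otimes>\<^bsub>P.Q\<^esub> \<beta> y) \<in> lin_hom K P.F P.Q"
        using ab[OF x] ab[OF y]
        by (auto simp: lin_hom_def hom P.Q.mult_add P.Q.add_mult P.Q.mult_smult P.Q.smult_mult)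
      show "(\<lambda>f. k \<odot>\<^bsub>P.Q\<^esub> P.proj f) \<in> lin_hom K P.F P.Q"
        using k by (auto simp: lin_hom_def hom P.Q.smult_r_distr K.m_comm simp flip: P.Q.smult_assoc1)
      fix p assume p: "p \<in> carrier (A \<times>\<times> ?L)" "f p \<noteq> \<zero>\<^bsub>K\<^esub>"
      obtain a b where pab: "p = (a, b)" by (cases p)
      have a: "a \<in> carrier A" and b: "b \<in> carrier ?L" using p(1) by (auto simp: pab pm)
      have pY: "p \<in> Y" using p(2) by (simp add: Y_def)
      have ua: "u \<otimes>\<^bsub>A\<^esub> a = a" "a \<otimes>\<^bsub>A\<^esub> v = a" using u(2)[OF pY] v(2)[OF pY] by (simp_all add: pab)
      have "b \<in> U.S.cls n ` carrier (U.T {..n})" using n pY by (force simp: pab)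
      from U.cls_slot_scaling[OF x y k xy this]
      have sb: "?s x \<otimes>\<^bsub>?L\<^esub> b \<otimes>\<^bsub>?L\<^esub> ?s y = k \<odot>\<^bsub>?L\<^esub> b" by (simp add: U.infinite_tensor_algebra_eq)
      have "\<alpha> x \<otimes>\<^bsub>P.Q\<^esub> P.proj (single K p) \<otimes>\<^bsub>P.Q\<^esub> \<beta> y = P.proj (single K (a, k \<odot>\<^bsub>?L\<^esub> b))"
        using a b u(1) v(1) s[OF x] s[OF y]
        by (simp add: \<alpha>_def \<beta>_def pab P.Q_mult P.single_mult pm ua sb)
      also have "\<dots> = P.proj (k \<odot>\<^bsub>P.F\<^esub> single K (a, b))"
      proof (rule P.proj_eqI)
        have "single K (a, k \<odot>\<^bsub>?L\<^esub> b) \<ominus>\<^bsub>P.F\<^esub> k \<odot>\<^bsub>P.F\<^esub> single K (a, b) \<in> tensor_rels K A ?L"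
          unfolding tensor_rels_def Let_def using a b k by blast
        then show "single K (a, k \<odot>\<^bsub>?L\<^esub> b) \<ominus>\<^bsub>P.F\<^esub> k \<odot>\<^bsub>P.F\<^esub> single K (a, b) \<in> P.N"
          using P.X_subset_N by blast
      qed (use a b k in \<open>auto simp: pm\<close>)
      also have "\<dots> = k \<odot>\<^bsub>P.Q\<^esub> P.proj (single K p)"
        using a b k by (simp add: P.Q_smult pab pm)
      finally show "\<alpha> x \<otimes>\<^bsub>P.Q\<^esub> P.proj (single K p) \<otimes>\<^bsub>P.Q\<^esub> \<beta> y = k \<odot>\<^bsub>P.Q\<^esub> P.proj (single K p)" .
    qed
    obtain x1 x2 y1 y2 where xy: "x1 \<in> carrier (B (Suc n))" "x2 \<in> carrier (B (Suc n))"
      "y1 \<in> carrier (B (Suc n))" "y2 \<in> carrier (B (Suc n))"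
      "x1 \<otimes>\<^bsub>B (Suc n)\<^esub> \<one>\<^bsub>B (Suc n)\<^esub> \<otimes>\<^bsub>B (Suc n)\<^esub> y1 = \<one>\<^bsub>B (Suc n)\<^esub>"
      "x1 \<otimes>\<^bsub>B (Suc n)\<^esub> \<one>\<^bsub>B (Suc n)\<^esub> \<otimes>\<^bsub>B (Suc n)\<^esub> y2 = \<zero>\<^bsub>B (Suc n)\<^esub>"
      "x2 \<otimes>\<^bsub>B (Suc n)\<^esub> \<one>\<^bsub>B (Suc n)\<^esub> \<otimes>\<^bsub>B (Suc n)\<^esub> y1 = \<zero>\<^bsub>B (Suc n)\<^esub>"
      "x2 \<otimes>\<^bsub>B (Suc n)\<^esub> \<one>\<^bsub>B (Suc n)\<^esub> \<otimes>\<^bsub>B (Suc n)\<^esub> y2 = \<one>\<^bsub>B (Suc n)\<^esub>"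
      using assms(5)[of "Suc n"] unfolding properly_infinite_def by blast
    have 1: "\<alpha> x \<otimes>\<^bsub>P.Q\<^esub> r \<otimes>\<^bsub>P.Q\<^esub> \<beta> y = r"
      if "x \<in> carrier (B (Suc n))" "y \<in> carrier (B (Suc n))"
        "x \<otimes>\<^bsub>B (Suc n)\<^esub> \<one>\<^bsub>B (Suc n)\<^esub> \<otimes>\<^bsub>B (Suc n)\<^esub> y = \<one>\<^bsub>B (Suc n)\<^esub>" for x y
      using scale[OF that(1,2) K.one_closed] that(3) r(1) U.B.one_closed by simp
    have 0: "\<alpha> x \<otimes>\<^bsub>P.Q\<^esub> r \<otimes>\<^bsub>P.Q\<^esub> \<beta> y = \<zero>\<^bsub>P.Q\<^esub>"
      if "x \<in> carrier (B (Suc n))" "y \<in> carrier (B (Suc n))"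
        "x \<otimes>\<^bsub>B (Suc n)\<^esub> \<one>\<^bsub>B (Suc n)\<^esub> \<otimes>\<^bsub>B (Suc n)\<^esub> y = \<zero>\<^bsub>B (Suc n)\<^esub>" for x y
      using scale[OF that(1,2) K.zero_closed] that(3) r(1) U.B.one_closed by simp
    show "properly_infinite P.Q r"
      unfolding properly_infinite_def
      using r xy ab 1 0
      by (intro conjI bexI[of _ "\<alpha> x1"] bexI[of _ "\<alpha> x2"] bexI[of _ "\<beta> y1"] bexI[of _ "\<beta> y2"]) simp_all
  qed
qed

end
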